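(* Let $\Theta\subseteq\mathbb{R}^l$ be a closed convex set, let $f:\mathbb{R}^n\times\mathbb{R}^m\to\mathbb{R}^n$ and $g:\mathbb{R}^n\times\mathbb{R}^m\to\mathbb{R}^{n\times l}$ be smooth with $f(0,0)=0$, $g(0,0)=0$, and consider the control system $\dot x=f(x,u)+g(x,u)\theta$ with state $x\in\mathbb{R}^n$, input $u\in\mathbb{R}^m$ and constant unknown parameter $\theta\in\Theta$. Suppose there are a smooth mapping $k:\Theta\times\mathbb{R}^n\to\mathbb{R}^m$ with $k(\theta,0)=0$ for all $\theta\in\Theta$, a constant $\sigma>0$, and a continuous mapping $V:\Theta\times\mathbb{R}^n\to\mathbb{R}_+$ such that for each $\theta\in\Theta$ the function $V(\theta,\cdot)$ is continuously differentiable, positive definite and radially unbounded, and such that: (H1) for each $\theta\in\Theta$, $0\in\mathbb{R}^n$ is globally asymptotically stable for $\dot x=f(x,k(\theta,x))+g(x,k(\theta,x))\theta$; more specifically, $\nabla V(\theta,x)\big(f(x,k(\theta,x))+g(x,k(\theta,x))\theta\big)\le-2\sigma V(\theta,x)$ for all $\theta\in\Theta$, $x\in\mathbb{R}^n$ (gradient with respect to $x$); (H2) for every non-empty compact set $\bar\Theta\subseteq\Theta$ and every $M\ge0$ there exists $R>0$ such that $V(\theta,x)\le M$ and $\theta\in\bar\Theta$ imply $|x|\le R$. Moreover, suppose that for each $\theta\in\Theta$, $0\in\mathbb{R}^n$ is locally exponentially stable for $\dot x=f(x,k(\theta,x))+g(x,k(\theta,x))\theta$, and that for every non-empty compact set $\bar\Theta\subseteq\Theta$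 there exist constants $R>0$, $K_2>K_1>0$ such that $$K_1|x|^2\le V(\theta,x)\le K_2|x|^2\quad\text{for all }x\in\mathbb{R}^n,\ \theta\in\bar\Theta\text{ with }|x|\le R.$$ Let $T>0$ be a constant and let $a:\mathbb{R}^n\to\mathbb{R}_+$ be a continuous, positive definite function satisfying $\sup\{|x|^{-2}a(x):x\in\mathbb{R}^n,\ x\ne0,\ |x|\le\delta\}<+\infty$ for a certain $\delta>0$. Then there exists a family of constants $M_{\theta,\hat\theta},\bar R_{\theta,\hat\theta}>0$, parameterized by $(\theta,\hat\theta)\in\Theta\times\Theta$, such that for every $\theta\in\Theta$, $x_0\in\mathbb{R}^n$, $\hat\theta_0\in\Theta$ with $|x_0|\le\bar R_{\theta,\hat\theta_0}$, the solution of the hybrid closed-loop system (the plant with the event-triggered adaptive controller and batch least-squares identifier built from $k,V,a,T$ as described in the context) with $x(0)=x_0$, $\hat\theta(0)=\hat\theta_0$ satisfies $|x(t)|\le M_{\theta,\hat\theta_0}\exp(-\sigma t)|x_0|$ for all $t\ge0$, where $\sigma>0$ is the constant in (H1).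
   Context: Notation: $|\cdot|$ is the Euclidean norm, $\mathbb{R}_+=[0,\infty)$, $\mathbb{Z}_+=\{0,1,2,\dots\}$, $A'$ is the transpose of $A$. $V:\mathbb{R}^n\to\mathbb{R}_+$ is positive definite if $V(0)=0$ and $V(x)>0$ for $x\ne0$; a continuous $V:\mathbb{R}^n\to\mathbb{R}_+$ is radially unbounded if $\{x:V(x)\le M\}$ is compact for every $M>0$. Hybrid closed-loop system. Given $k,V,a,T$ and the (unknown to the controller) parameter $\theta\in\Theta$, a solution consists of a continuous function $x(t)\in\mathbb{R}^n$, a right-continuous piecewise constant function $\hat\theta(t)\in\Theta$, and event times $0=\tau_0<\tau_1<\tau_2<\dots$ such that: (1) Control between events: for $t\in[\tau_i,\tau_{i+1})$, $i\in\mathbb{Z}_+$, one has $\hat\theta(t)=\hat\theta(\tau_i)$, $u(t)=k(\hat\theta(\tau_i),x(t))$ and $\dot x(t)=f(x(t),u(t))+g(x(t),u(t))\theta$ (right derivative at $t=\tau_i$). (2) Event times: $\tau_{i+1}=\min(\tau_i+T,r_i)$, where, if $x(\tau_i)\ne0$, $$r_i=\inf\{t>\tau_i:\ V(\hat\theta(\tau_i),x(t))=V(\hat\theta(\tau_i),x(\tau_i))+a(x(\tau_i))\}$$ with $x(t)$ the solution of the plant started from $x(\tau_i)$ at time $\tau_i$ with $u(t)=k(\hat\theta(\tau_i),x(t))$ ($r_i=+\infty$ if no such $t$ exists), and $r_i=\tau_i+T$ if $x(\tau_i)=0$. (3) Parameter update (batch least-squares identifier): with $$p(t,s)=x(t)-x(s)-\int_s^t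 f(x(r),u(r))\,dr,\qquad q(t,s)=\int_s^t g(x(r),u(r))\,dr,$$ $\hat\theta(\tau_{i+1})$ is the unique minimizer of $|\vartheta-\hat\theta(\tau_i)|^2$ over all $\vartheta\in\Theta$ satisfying $$\int_0^{\tau_{i+1}}\!\!\int_0^{\tau_{i+1}} q'(t,s)p(t,s)\,ds\,dt=\Big(\int_0^{\tau_{i+1}}\!\!\int_0^{\tau_{i+1}} q'(t,s)q(t,s)\,ds\,dt\Big)\vartheta .$$ (The constraint set is non-empty, since it contains $\theta$.) *)

theory Defs
  imports "HOL-Analysis.Analysis"
begin

text \<open>C^k on an open set \<open>S\<close>; in finite dimension, continuity of all iterated directional
  derivatives is the same as continuity of the iterated Frechet derivatives.\<close>

primrec Ck_on :: "nat \<Rightarrow> 'a::real_normed_vector set \<Rightarrow> ('a \<Rightarrow> 'b::real_normed_vector) \<Rightarrow> bool"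
  where
    "Ck_on 0 S h \<longleftrightarrow> continuous_on S h"
  | "Ck_on (Suc j) S h \<longleftrightarrow>
       (\<forall>x\<in>S. h differentiable (at x)) \<and> (\<forall>v. Ck_on j S (\<lambda>x. frechet_derivative h (at x) v))"

text \<open>On a set that need not be open, a smooth map is one that extends to a smooth map near
  every point of the set.\<close>

definition smooth_map_on ::
    "'a::real_normed_vector set \<Rightarrow> ('a \<Rightarrow> 'b::real_normed_vector) \<Rightarrow> bool"
  where "smooth_map_on S h \<longleftrightarrow>
    (\<forall>x\<in>S. \<exists>U H. open U \<and> x \<in> U \<and> (\<forall>j. Ck_on j U H) \<and> (\<forall>y\<in>U \<inter> S. H y = h y))"

definition pos_def_fun :: "('a::real_normed_vector \<Rightarrow> real) \<Rightarrow> bool"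
  where "pos_def_fun W \<longleftrightarrow> W 0 = 0 \<and> (\<forall>x. x \<noteq> 0 \<longrightarrow> 0 < W x)"

definition radially_unbounded :: "('a::real_normed_vector \<Rightarrow> real) \<Rightarrow> bool"
  where "radially_unbounded W \<longleftrightarrow> (\<forall>M>0. compact {x. W x \<le> M})"

text \<open>The derivative is taken within \<open>I\<close>, hence one-sided at end points belonging to \<open>I\<close>.\<close>

definition ode_solution ::
    "('a::real_normed_vector \<Rightarrow> 'a) \<Rightarrow> real set \<Rightarrow> (real \<Rightarrow> 'a) \<Rightarrow> bool"
  where "ode_solution F I y \<longleftrightarrow> (\<forall>t\<in>I. (y has_vector_derivative F (y t)) (at t within I))"

definition glob_asymp_stable :: "('a::real_normed_vector \<Rightarrow> 'a) \<Rightarrow> bool"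
  where "glob_asymp_stable F \<longleftrightarrow>
    (\<forall>x0. \<exists>y. ode_solution F {0..} y \<and> y 0 = x0) \<and>
    (\<forall>\<epsilon>>0. \<exists>\<delta>>0. \<forall>y. ode_solution F {0..} y \<and> norm (y 0) \<le> \<delta> \<longrightarrow> (\<forall>t\<ge>0. norm (y t) \<le> \<epsilon>)) \<and>
    (\<forall>y. ode_solution F {0..} y \<longrightarrow> (y \<longlongrightarrow> 0) at_top)"

definition loc_exp_stable :: "('a::real_normed_vector \<Rightarrow> 'a) \<Rightarrow> bool"
  where "loc_exp_stable F \<longleftrightarrow>
    (\<exists>\<delta>>0. \<exists>C>0. \<exists>\<mu>>0.
      (\<forall>x0. norm x0 \<le> \<delta> \<longrightarrow> (\<exists>y. ode_solution F {0..} y \<and> y 0 = x0)) \<and>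
      (\<forall>y. ode_solution F {0..} y \<and> norm (y 0) \<le> \<delta> \<longrightarrow>
        (\<forall>t\<ge>0. norm (y t) \<le> C * exp (- \<mu> * t) * norm (y 0))))"

text \<open>The plant with true parameter \<open>\<theta>\<close> under the static feedback \<open>u = k (\<eta>, x)\<close>, where \<open>\<eta>\<close> is
  the parameter value used by the controller.\<close>

definition loop_field ::
    "((real^'n) \<times> (real^'m) \<Rightarrow> real^'n) \<Rightarrow> ((real^'n) \<times> (real^'m) \<Rightarrow> real^'l^'n) \<Rightarrow>
     ((real^'l) \<times> (real^'n) \<Rightarrow> real^'m) \<Rightarrow> real^'l \<Rightarrow> real^'l \<Rightarrow> real^'n \<Rightarrow> real^'n"
  where "loop_field f g k \<theta> \<eta> x = f (x, k (\<eta>, x)) + g (x, k (\<eta>, x)) *v \<theta>"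

text \<open>The times \<open>t > s\<close> at which the solution of \<open>y' = F y\<close>, \<open>y s = \<xi>\<close> exists and has
  \<open>W (y t) = c\<close>.\<close>

definition hitting_times ::
    "('a::real_normed_vector \<Rightarrow> 'a) \<Rightarrow> ('a \<Rightarrow> real) \<Rightarrow> real \<Rightarrow> 'a \<Rightarrow> real \<Rightarrow> real set"
  where "hitting_times F W s \<xi> c =
    {t. s < t \<and> (\<exists>y. ode_solution F {s..t} y \<and> y s = \<xi> \<and> W (y t) = c)}"

text \<open>As an extended real the infimum of the empty set is \<open>\<infinity>\<close>.\<close>

definition trigger_time ::
    "('a::real_normed_vector \<Rightarrow> 'a) \<Rightarrow> ('a \<Rightarrow> real) \<Rightarrow> ('a \<Rightarrow> real) \<Rightarrow> real \<Rightarrow> real \<Rightarrow> 'a \<Rightarrow> ereal"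
  where "trigger_time F W a T s \<xi> =
    (if \<xi> = 0 then ereal (s + T) else (INF t\<in>hitting_times F W s \<xi> (W \<xi> + a \<xi>). ereal t))"

text \<open>The integrals over \<open>r\<close> are oriented, so that \<open>t < s\<close> is covered.\<close>

definition lsq_p ::
    "((real^'n) \<times> (real^'m) \<Rightarrow> real^'n) \<Rightarrow> (real \<Rightarrow> real^'n) \<Rightarrow> (real \<Rightarrow> real^'m) \<Rightarrow>
     real \<Rightarrow> real \<Rightarrow> real^'n"
  where "lsq_p f x u t s = x t - x s - (LBINT r=ereal s..ereal t. f (x r, u r))"

definition lsq_q ::
    "((real^'n) \<times> (real^'m) \<Rightarrow> real^'l^'n) \<Rightarrow> (real \<Rightarrow> real^'n) \<Rightarrow> (real \<Rightarrow> real^'m) \<Rightarrow>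
     real \<Rightarrow> real \<Rightarrow> real^'l^'n"
  where "lsq_q g x u t s = (LBINT r=ereal s..ereal t. g (x r, u r))"

definition lsq_feasible ::
    "(real^'l) set \<Rightarrow> ((real^'n) \<times> (real^'m) \<Rightarrow> real^'n) \<Rightarrow>
     ((real^'n) \<times> (real^'m) \<Rightarrow> real^'l^'n) \<Rightarrow> (real \<Rightarrow> real^'n) \<Rightarrow> (real \<Rightarrow> real^'m) \<Rightarrow> real \<Rightarrow>
     (real^'l) set"
  where "lsq_feasible \<Theta> f g x u b =
    {\<zeta>\<in>\<Theta>.
      (LBINT t=ereal 0..ereal b. (LBINT s=ereal 0..ereal b.
          transpose (lsq_q g x u t s) *v lsq_p f x u t s)) =
      (LBINT t=ereal 0..ereal b. (LBINT s=ereal 0..ereal b.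
          transpose (lsq_q g x u t s) ** lsq_q g x u t s)) *v \<zeta>}"

definition is_unique_arg_min :: "('a \<Rightarrow> real) \<Rightarrow> 'a set \<Rightarrow> 'a \<Rightarrow> bool"
  where "is_unique_arg_min J S z \<longleftrightarrow>
    is_arg_min J (\<lambda>y. y \<in> S) z \<and> (\<forall>y. is_arg_min J (\<lambda>y. y \<in> S) y \<longrightarrow> y = z)"

text \<open>The domain of a solution is the union of the inter-event intervals; the definition does not
  by itself exclude event times that accumulate. On that domain the input is
  \<open>u t = k (\<theta>h t, x t)\<close>, and \<open>\<theta>h t = \<theta>h (\<tau> i)\<close> between events.\<close>

definition hybrid_solution ::
    "(real^'l) set \<Rightarrow> ((real^'n) \<times> (real^'m) \<Rightarrow> real^'n) \<Rightarrow>
     ((real^'n) \<times> (real^'m) \<Rightarrow> real^'l^'n) \<Rightarrow> ((real^'l) \<times> (real^'n) \<Rightarrow> real^'m) \<Rightarrow>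
     ((real^'l) \<times> (real^'n) \<Rightarrow> real) \<Rightarrow> (real^'n \<Rightarrow> real) \<Rightarrow> real \<Rightarrow> real^'l \<Rightarrow>
     (real \<Rightarrow> real^'n) \<Rightarrow> (real \<Rightarrow> real^'l) \<Rightarrow> (nat \<Rightarrow> real) \<Rightarrow> bool"
  where "hybrid_solution \<Theta> f g k V a T \<theta> x \<theta>h \<tau> \<longleftrightarrow>
    \<tau> 0 = 0 \<and> strict_mono \<tau> \<and>
    continuous_on (\<Union>i. {\<tau> i..<\<tau> (Suc i)}) x \<and>
    (\<forall>i. \<theta>h (\<tau> i) \<in> \<Theta>) \<and>
    (\<forall>i. \<forall>t\<in>{\<tau> i..<\<tau> (Suc i)}. \<theta>h t = \<theta>h (\<tau> i)) \<and>
    (\<forall>i. ode_solution (loop_field f g k \<theta> (\<theta>h (\<tau> i))) {\<tau> i..<\<tau> (Suc i)} x) \<and>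
    (\<forall>i. ereal (\<tau> (Suc i)) =
           min (ereal (\<tau> i + T))
               (trigger_time (loop_field f g k \<theta> (\<theta>h (\<tau> i))) (\<lambda>y. V (\<theta>h (\<tau> i), y)) a T
                  (\<tau> i) (x (\<tau> i)))) \<and>
    (\<forall>i. is_unique_arg_min (\<lambda>\<zeta>. (norm (\<zeta> - \<theta>h (\<tau> i)))\<^sup>2)
           (lsq_feasible \<Theta> f g x (\<lambda>t. k (\<theta>h t, x t)) (\<tau> (Suc i))) (\<theta>h (\<tau> (Suc i))))"

end

theory Submission
  imports Defs
begin

text \<open>
  Along any solution the true parameter \<open>\<theta>\<close> is feasible for the least-squares problem, and the
  feasible set is the part of \<open>\<Theta>\<close> in \<open>\<theta> + N\<close>, where \<open>N\<close> is the space of all \<open>v\<close> with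
  \<open>g (x r, u r) v = 0\<close> for all past \<open>r\<close>. Hence the estimates, being successive projections, stay in a
  ball around \<open>\<theta>\<close>, and every update that changes the estimate lowers the dimension of \<open>N\<close>: there
  are at most \<open>l\<close> of them. If the estimate \<open>\<eta>\<close> is not changed at the end of an inter-event interval,
  then on that interval the plant cannot be told from the plant with parameter \<open>\<eta>\<close>, so that
  \<open>V (\<eta>, x t)\<close> decays like \<open>exp (- 2 \<sigma> t)\<close>, the trigger is not hit, and the interval has length
  \<open>T\<close>. On the other intervals the trigger and the quadratic bounds on \<open>V\<close> and \<open>a\<close> limit the growth of
  \<open>exp (2 \<sigma> t) V\<close> to a constant factor. The product of at most \<open>l + 1\<close> such factors gives the
  estimate, and for small initial states it keeps the solution in the ball in which the quadratic
  bounds hold.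
\<close>

section \<open>Ordinary differential equations\<close>

text \<open>A bound for all \<open>t \<ge> 0\<close> means little if no solution exists or if the
  event times accumulate. So existence, uniqueness and divergence of the event times are proved
  together with the estimate, over finitely many steps at a time. The three are entangled: a small
  state makes the quadratic bounds available, these control V on the next interval, and this control
  keeps the state in the ball and makes the next event occur before the plant can leave it. Instead
  of the updates, the directions excited so far are counted, \<open>l - dim N\<close>. This number
  never decreases, rises with every update, and keeps two accounts: the power of the growth factor
  in the bound for \<open>exp (2 \<sigma> t) V\<close>, and the number of intervals that may be
  shorter than T. The second account gives \<open>\<tau> n \<ge> T * (n - l)\<close>. The constants
  may depend on \<theta> and the initial estimate only. This works because the parameter error never
  grows: all estimates lie in one compact part of \<Theta>, where the quadratic bounds are uniform.
  The rate is \<sigma> and not \<open>2 \<sigma>\<close> because V is comparable to the square of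
  the norm.\<close>

lemma lipschitz_ode_exists:
  fixes F :: "'a::euclidean_space \<Rightarrow> 'a"
  assumes lip: "L-lipschitz_on UNIV F" and "a \<le> b"
  shows "\<exists>y. ode_solution F {a..b} y \<and> y a = \<xi>"
proof -
  have L0: "0 \<le> L" by (rule lipschitz_on_nonneg[OF lip])
  have contF: "continuous_on UNIV F" by (rule lipschitz_on_continuous_on[OF lip])
  \<comment> \<open>With the weight \<open>exp (- c * (t - a))\<close> the Picard operator contracts on the whole interval.\<close>
  define c where "c = 2 * L + 1"
  have c0: "c > 0" using L0 by (simp add: c_def)
  define G where "G z r = F (exp (c * (r - a)) *\<^sub>R z r)" for z and r
  define J where "J z t = exp (- c * (t - a)) *\<^sub>R (\<xi> + integral {a..t} (G z))" for z t
  \<comment> \<open>Clamping \<open>t\<close> to \<open>{a..b}\<close> makes \<open>P z\<close> a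
    bounded continuous function on the whole line, so that Banach's theorem applies in the complete
    space of such functions.\<close>
  define P where "P z = Bcontfun (\<lambda>t. J (apply_bcontfun z) (max a (min b t)))"
    for z :: "real \<Rightarrow>\<^sub>C 'a"
  have contG: "continuous_on S (G (apply_bcontfun z))" for z :: "real \<Rightarrow>\<^sub>C 'a" and S
    unfolding G_def
    by (rule continuous_on_compose2[OF contF]) (auto intro!: continuous_intros)
  have contJ: "continuous_on {a..b} (J (apply_bcontfun z))" for z :: "real \<Rightarrow>\<^sub>C 'a"
    unfolding J_def
    by (intro continuous_intros indefinite_integral_continuous_1 integrable_continuous_real contG)
  have inb: "(\<lambda>t. J (apply_bcontfun z) (max a (min b t))) \<in> bcontfun" for z :: "real \<Rightarrow>\<^sub>C 'a"
  proof -
    have "bounded (J (apply_bcontfun z) ` {a..b})"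
      by (intro compact_imp_bounded compact_continuous_image contJ) auto
    then obtain B where B: "\<forall>t\<in>{a..b}. norm (J (apply_bcontfun z) t) \<le> B"
      unfolding bounded_iff by auto
    show ?thesis
    proof (rule bcontfun_normI)
      show "continuous_on UNIV (\<lambda>t. J (apply_bcontfun z) (max a (min b t)))"
        by (rule continuous_on_compose2[OF contJ]) (use \<open>a \<le> b\<close> in \<open>auto intro!: continuous_intros\<close>)
      show "norm (J (apply_bcontfun z) (max a (min b t))) \<le> B" for t
        by (rule B[rule_format]) (use \<open>a \<le> b\<close> in auto)
    qed
  qed
  have P: "apply_bcontfun (P z) t = J (apply_bcontfun z) (max a (min b t))" for z t
    unfolding P_def using inb[of z] by (simp add: Bcontfun_inverse)
  have contr: "dist (P z) (P w) \<le> 1/2 * dist z w" for z w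
  proof (rule dist_bound)
    fix t :: real
    define s where "s = max a (min b t)"
    have s: "a \<le> s" "s \<le> b" using \<open>a \<le> b\<close> by (auto simp: s_def)
    have "((\<lambda>r. L * dist z w * exp (c * (r - a))) has_integral
        (L * dist z w * (exp (c * (s - a)) / c) - L * dist z w * (exp (c * (a - a)) / c))) {a..s}"
      by (rule fundamental_theorem_of_calculus[OF s(1)])
        (use c0 in \<open>auto intro!: derivative_eq_intros simp flip: has_real_derivative_iff_has_vector_derivative\<close>)
    then have int: "((\<lambda>r. L * dist z w * exp (c * (r - a))) has_integral
        (L * dist z w * (exp (c * (s - a)) - 1) / c)) {a..s}"
      by (simp add: diff_divide_distrib right_diff_distrib)
    have "norm (integral {a..s} (G z) - integral {a..s} (G w))
       = norm (integral {a..s} (\<lambda>r. G z r - G w r))"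
      by (subst integral_diff) (auto intro!: integrable_continuous_real contG)
    also have "\<dots> \<le> integral {a..s} (\<lambda>r. L * dist z w * exp (c * (r - a)))"
    proof (rule integral_norm_bound_integral)
      show "(\<lambda>r. G z r - G w r) integrable_on {a..s}"
        by (intro integrable_continuous_real continuous_intros contG)
      show "(\<lambda>r. L * dist z w * exp (c * (r - a))) integrable_on {a..s}" using int by blast
      fix r assume "r \<in> {a..s}"
      have "norm (G z r - G w r) \<le> L * norm (exp (c * (r - a)) *\<^sub>R z r - exp (c * (r - a)) *\<^sub>R w r)"
        unfolding G_def by (rule lipschitz_on_normD[OF lip]) auto
      also have "\<dots> = L * (exp (c * (r - a)) * dist (z r) (w r))"
        by (simp add: dist_norm flip: scaleR_diff_right)
      also have "\<dots> \<le> L * (exp (c * (r - a)) * dist z w)"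
        by (intro mult_left_mono dist_bounded L0) auto
      finally show "norm (G z r - G w r) \<le> L * dist z w * exp (c * (r - a))"
        by (simp add: mult_ac)
    qed
    also have "\<dots> = L * dist z w * (exp (c * (s - a)) - 1) / c" using int by blast
    also have "\<dots> \<le> L * dist z w * exp (c * (s - a)) / c"
      using c0 L0 by (intro divide_right_mono mult_left_mono) auto
    finally have *: "norm (integral {a..s} (G z) - integral {a..s} (G w))
      \<le> L * dist z w * exp (c * (s - a)) / c" .
    have "dist (J z s) (J w s) = exp (- c * (s - a)) * norm (integral {a..s} (G z) - integral {a..s} (G w))"
      unfolding J_def dist_norm by (simp flip: scaleR_diff_right)
    also have "\<dots> \<le> exp (- c * (s - a)) * (L * dist z w * exp (c * (s - a)) / c)"
      by (intro mult_left_mono *) auto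
    also have "\<dots> = (exp (- c * (s - a)) * exp (c * (s - a))) * (L / c * dist z w)" by simp
    also have "\<dots> = L / c * dist z w" by (simp flip: exp_add)
    also have "\<dots> \<le> 1/2 * dist z w"
      by (intro mult_right_mono) (use c0 in \<open>auto simp: c_def field_simps\<close>)
    finally show "dist (apply_bcontfun (P z) t) (apply_bcontfun (P w) t) \<le> 1/2 * dist z w"
      unfolding P s_def .
  qed
  obtain z where z: "P z = z"
    using banach_fix_type[of "1/2" P] contr by auto
  have zt: "z t = J z t" if "t \<in> {a..b}" for t
    using P[of z t] that by (simp add: z)
  define y where "y t = \<xi> + integral {a..t} (G z)" for t
  have y: "y t = exp (c * (t - a)) *\<^sub>R z t" if "t \<in> {a..b}" for t
    unfolding zt[OF that] J_def y_def by (simp flip: exp_add)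
  have "(y has_vector_derivative F (y t)) (at t within {a..b})" if t: "t \<in> {a..b}" for t
  proof -
    have "((\<lambda>t. integral {a..t} (G z)) has_vector_derivative G z t) (at t within {a..b})"
      by (rule integral_has_vector_derivative[OF contG t])
    then have "(y has_vector_derivative G z t) (at t within {a..b})"
      unfolding y_def by (auto intro!: derivative_eq_intros)
    then show ?thesis by (simp add: y[OF t] G_def)
  qed
  moreover have "y a = \<xi>" by (simp add: y_def)
  ultimately show ?thesis unfolding ode_solution_def by blast
qed

lemma ico_subset: "{a..<b} \<subseteq> {a..b::'a::preorder}"
  by (auto intro: less_imp_le)

lemma ode_solution_subset: "ode_solution F I y \<Longrightarrow> J \<subseteq> I \<Longrightarrow> ode_solution F J y"
  unfolding ode_solution_def using has_vector_derivative_within_subset by blast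

lemma ode_solution_continuous_on: "ode_solution F I y \<Longrightarrow> continuous_on I y"
  unfolding ode_solution_def continuous_on_eq_continuous_within
  using has_vector_derivative_continuous by blast

lemma ode_solution_cong:
  assumes "ode_solution F I x" "\<And>t. t \<in> I \<Longrightarrow> y t = x t"
  shows "ode_solution F I y"
  unfolding ode_solution_def
proof
  fix t assume t: "t \<in> I"
  have "(x has_vector_derivative F (y t)) (at t within I)"
    using assms(1) t unfolding ode_solution_def assms(2)[OF t] by blast
  with t assms(2) show "(y has_vector_derivative F (y t)) (at t within I)"
    by (rule has_vector_derivative_transform)
qed

lemma ode_solution_interior:
  assumes "ode_solution F {a..<b} y" "a < t" "t < b"
  shows "(y has_vector_derivative F (y t)) (at t)"
proof -
  have "(y has_vector_derivative F (y t)) (at t within {a<..<b})"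
    using assms(1)[unfolded ode_solution_def, rule_format, of t] assms(2,3)
    by (intro has_vector_derivative_within_subset[of y _ t "{a..<b}" "{a<..<b}"]) auto
  then show ?thesis using at_within_open[of t "{a<..<b}"] assms(2,3) by simp
qed

text \<open>Balls instead of neighbourhoods of points: two bounded solutions then share one
  Lipschitz constant.\<close>

definition locally_lip :: "('a::real_normed_vector \<Rightarrow> 'b::real_normed_vector) \<Rightarrow> bool"
  where "locally_lip F \<longleftrightarrow> (\<forall>r. \<exists>L. L-lipschitz_on (cball 0 r) F)"

text \<open>The squared distance of the two solutions, weighted by \<open>exp (- 2 * L * s)\<close>,
  is non-increasing. At \<open>b\<close> only continuity is assumed, because a trajectory follows a
  fixed field just on a half-open inter-event interval; the state at \<open>b\<close> is covered
  nevertheless, since the next interval starts there.\<close>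

lemma ode_solution_unique:
  fixes F :: "'a::euclidean_space \<Rightarrow> 'a"
  assumes lip: "locally_lip F"
    and y: "ode_solution F {a..<b} y" "continuous_on {a..b} y"
    and z: "ode_solution F {a..<b} z" "continuous_on {a..b} z"
    and eq: "y a = z a" and t: "t \<in> {a..b}"
  shows "y t = z t"
proof -
  have "bounded (y ` {a..b})" "bounded (z ` {a..b})"
    by (intro compact_imp_bounded compact_continuous_image y z compact_Icc)+
  then have "bounded (y ` {a..b} \<union> z ` {a..b})" by simp
  then obtain r where r: "\<forall>x\<in>y ` {a..b} \<union> z ` {a..b}. norm x \<le> r"
    unfolding bounded_iff by auto
  obtain L where L: "L-lipschitz_on (cball 0 r) F" using lip unfolding locally_lip_def by blast
  define \<phi> where "\<phi> s = exp (- 2 * L * s) * ((y s - z s) \<bullet> (y s - z s))" for s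
  have "\<phi> t \<le> \<phi> a"
  proof (rule DERIV_nonpos_imp_decreasing_open[of a t \<phi>])
    show "a \<le> t" using t by auto
    have "continuous_on {a..b} \<phi>" unfolding \<phi>_def by (intro continuous_intros y z)
    then show "continuous_on {a..t} \<phi>" by (rule continuous_on_subset) (use t in auto)
    fix s assume s: "a < s" "s < t"
    then have sb: "s \<in> {a..b}" "s < b" using t by auto
    have dy: "(y has_vector_derivative F (y s)) (at s)" and dz: "(z has_vector_derivative F (z s)) (at s)"
      using ode_solution_interior[OF y(1)] ode_solution_interior[OF z(1)] s sb by auto
    have dd: "((\<lambda>s. y s - z s) has_derivative (\<lambda>h. h *\<^sub>R (F (y s) - F (z s)))) (at s)"
      using has_vector_derivative_diff[OF dy dz] unfolding has_vector_derivative_def .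
    have "((\<lambda>s. (y s - z s) \<bullet> (y s - z s)) has_real_derivative
        2 * ((y s - z s) \<bullet> (F (y s) - F (z s)))) (at s)"
      unfolding has_field_derivative_def
      by (rule has_derivative_eq_rhs[OF has_derivative_inner[OF dd dd]])
        (auto simp: inner_commute algebra_simps)
    note dsq = this
    have dexp: "((\<lambda>s. exp (- 2 * L * s)) has_real_derivative exp (- 2 * L * s) * (- 2 * L)) (at s)"
      by (auto intro!: derivative_eq_intros)
    have "(\<phi> has_real_derivative exp (- 2 * L * s) *
        (2 * ((y s - z s) \<bullet> (F (y s) - F (z s))) - 2 * L * ((y s - z s) \<bullet> (y s - z s)))) (at s)"
      unfolding \<phi>_def by (rule DERIV_cong[OF DERIV_mult[OF dexp dsq]])
        (simp add: right_diff_distrib mult_ac)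
    moreover have "(y s - z s) \<bullet> (F (y s) - F (z s)) \<le> L * ((y s - z s) \<bullet> (y s - z s))"
    proof -
      have "(y s - z s) \<bullet> (F (y s) - F (z s)) \<le> norm (y s - z s) * norm (F (y s) - F (z s))"
        by (rule norm_cauchy_schwarz)
      also have "\<dots> \<le> norm (y s - z s) * (L * norm (y s - z s))"
        by (intro mult_left_mono lipschitz_on_normD[OF L]) (use r sb in auto)
      finally show ?thesis by (simp add: dot_square_norm power2_eq_square mult_ac)
    qed
    then have "exp (- 2 * L * s) *
        (2 * ((y s - z s) \<bullet> (F (y s) - F (z s))) - 2 * L * ((y s - z s) \<bullet> (y s - z s))) \<le> 0"
      by (intro mult_nonneg_nonpos) auto
    ultimately show "\<exists>D. (\<phi> has_real_derivative D) (at s) \<and> D \<le> 0" by blast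
  qed
  then have "exp (- 2 * L * t) * ((y t - z t) \<bullet> (y t - z t)) \<le> 0"
    by (simp add: \<phi>_def eq)
  then have "(y t - z t) \<bullet> (y t - z t) \<le> 0"
    by (simp add: mult_le_0_iff)
  then show ?thesis by (metis inner_gt_zero_iff linorder_not_less right_minus_eq)
qed

text \<open>A locally Lipschitz field may blow up in finite time, so existence is only obtained up
  to the time bound or up to the arrival at the sphere of radius \<open>r\<close>. Until then the
  original and the truncated field agree along the solution.\<close>

lemma ode_solution_until_exit:
  fixes F :: "'a::euclidean_space \<Rightarrow> 'a"
  assumes lip: "locally_lip F" and \<xi>: "norm \<xi> < r" and "T > 0"
  obtains y e where "s < e" "e \<le> s + T" "ode_solution F {s..e} y" "y s = \<xi>"
    "e = s + T \<or> norm (y e) = r"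
proof -
  have r: "r > 0" using \<xi> norm_ge_zero[of \<xi>] by linarith
  let ?C = "cball 0 r :: 'a set"
  obtain L where L: "L-lipschitz_on ?C F" using lip unfolding locally_lip_def by blast
  \<comment> \<open>Precomposed with the projection onto the ball, the field is globally Lipschitz.\<close>
  have "1-lipschitz_on UNIV (closest_point ?C)"
    using r closest_point_lipschitz[of ?C] by (intro lipschitz_onI) auto
  moreover have "closest_point ?C ` UNIV \<subseteq> ?C"
    using r closest_point_in_set[of ?C] by fastforce
  ultimately have "(L * 1)-lipschitz_on UNIV (\<lambda>x. F (closest_point ?C x))"
    using L by (intro lipschitz_on_compose2) (auto intro: lipschitz_on_subset)
  from lipschitz_ode_exists[OF this, of s "s + T" \<xi>] \<open>T > 0\<close>
  obtain y where y: "ode_solution (\<lambda>x. F (closest_point ?C x)) {s..s+T} y" "y s = \<xi>" by auto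
  have sol: "ode_solution F {s..e} y" if "e \<le> s + T" "\<And>t. t \<in> {s..e} \<Longrightarrow> norm (y t) \<le> r" for e
    using ode_solution_subset[OF y(1), of "{s..e}"] that closest_point_self[of _ ?C]
    unfolding ode_solution_def by auto
  have cy: "continuous_on {s..s+T} y" by (rule ode_solution_continuous_on[OF y(1)])
  show thesis
  proof (cases "\<forall>t\<in>{s..s+T}. norm (y t) \<le> r")
    case True
    then show thesis using that[of "s + T" y] sol[of "s + T"] y \<open>T > 0\<close> by auto
  next
    case False
    then obtain t1 where t1: "t1 \<in> {s..s+T}" "norm (y t1) > r" by force
    have "\<exists>e\<ge>s. e \<le> t1 \<and> norm (y e) = r \<and> (\<forall>t. s \<le> t \<and> t < e \<longrightarrow> norm (y t) \<noteq> r)"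
    proof -
      let ?S = "{t\<in>{s..t1}. norm (y t) = r}"
      have c1: "continuous_on {s..t1} (\<lambda>t. norm (y t))"
        using continuous_on_subset[OF cy] t1 by (auto intro!: continuous_intros)
      have "closed ?S"
        using continuous_closed_preimage[OF c1, of "{r}"] by (simp add: vimage_def Int_def)
      moreover have "bounded ?S" by (rule bounded_subset[of "{s..t1}"]) auto
      ultimately have "compact ?S" by (simp add: compact_eq_bounded_closed)
      moreover have "?S \<noteq> {}"
        using IVT'[of "\<lambda>t. norm (y t)" s r t1] c1 t1 y(2) \<xi> by auto
      ultimately obtain e where "e \<in> ?S" "\<forall>t\<in>?S. e \<le> t"
        using compact_attains_inf[of ?S] by blast
      then show ?thesis by force
    qed
    then obtain e where e: "s \<le> e" "e \<le> t1" "norm (y e) = r"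
      "\<And>t. s \<le> t \<Longrightarrow> t < e \<Longrightarrow> norm (y t) \<noteq> r" by blast
    have se: "s < e" using e y(2) \<xi> by (metis less_irrefl order_le_less)
    have "norm (y t) \<le> r" if t: "t \<in> {s..e}" for t
    proof (rule ccontr)
      assume *: "\<not> norm (y t) \<le> r"
      have ct: "continuous_on {s..t} (\<lambda>t. norm (y t))"
        using continuous_on_subset[OF cy, of "{s..t}"] t t1 e by (auto intro!: continuous_intros)
      obtain u where "s \<le> u" "u \<le> t" "norm (y u) = r"
        using IVT'[of "\<lambda>t. norm (y t)" s r t] ct * y(2) \<xi> t by auto
      moreover have "u \<noteq> e" "t \<noteq> e" using e(3) * \<open>u \<le> t\<close> t by auto
      ultimately show False using e(4)[of u] t by auto
    qed
    then show thesis using that[of e y] sol[of e] y se e t1 by auto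
  qed
qed

section \<open>Trigger times\<close>

text \<open>\<open>hitting_times\<close> speaks of some solution of the equation, which may live
  beyond \<open>b\<close>, and not of the given trajectory. Uniqueness identifies the two on their
  common interval.\<close>

lemma hitting_timesD:
  fixes F :: "'a::euclidean_space \<Rightarrow> 'a"
  assumes lip: "locally_lip F"
    and x: "ode_solution F {s..<b} x" "continuous_on {s..b} x" "x s = \<xi>"
    and t: "t \<in> hitting_times F W s \<xi> c"
  obtains y where "s < t" "ode_solution F {s..t} y" "W (y t) = c"
    "\<And>r. r \<in> {s..min b t} \<Longrightarrow> y r = x r"
proof -
  obtain y where y: "s < t" "ode_solution F {s..t} y" "y s = \<xi>" "W (y t) = c"
    using t unfolding hitting_times_def by auto
  have "y r = x r" if r: "r \<in> {s..min b t}" for r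
    by (rule ode_solution_unique[OF lip _ _ _ _ _ r])
      (use y x in \<open>auto intro: ode_solution_subset continuous_on_subset ode_solution_continuous_on\<close>)
  with y show thesis by (intro that[of y]) auto
qed

lemma trigger_time_le:
  assumes "\<xi> \<noteq> 0" "t \<in> hitting_times F W s \<xi> (W \<xi> + a \<xi>)"
  shows "trigger_time F W a T s \<xi> \<le> ereal t"
  using assms by (auto simp: trigger_time_def intro: INF_lower)

text \<open>Before \<open>b\<close> there is no hitting time, so by the intermediate value theorem
  the trigger level is not exceeded. If the interval is shorter than \<open>T\<close>, then
  \<open>b\<close> is the infimum of the hitting times; it is attained or is a limit of them, and
  continuity puts the value at \<open>b\<close> on the level. A start at 0 is harmless: the solution
  rests there.\<close>

lemma
  fixes F :: "'a::euclidean_space \<Rightarrow> 'a"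
  assumes lip: "locally_lip F" and F0: "F 0 = 0"
    and W: "continuous_on UNIV W" and a: "pos_def_fun a"
    and x: "ode_solution F {s..<b} x" "continuous_on {s..b} x" and sb: "s < b"
    and b: "ereal b = min (ereal (s + T)) (trigger_time F W a T s (x s))"
  shows trigger_step_le: "t \<in> {s..b} \<Longrightarrow> W (x t) \<le> W (x s) + a (x s)"
    and trigger_step_length: "b \<le> s + T"
    and trigger_step_eq: "b < s + T \<Longrightarrow> x s \<noteq> 0 \<and> W (x b) = W (x s) + a (x s)"
proof -
  let ?c = "W (x s) + a (x s)"
  have Wx: "continuous_on {s..b} (\<lambda>t. W (x t))"
    by (rule continuous_on_compose2[OF W x(2)]) auto
  have a0: "a 0 = 0" and apos: "\<And>x. x \<noteq> 0 \<Longrightarrow> a x > 0" using a by (auto simp: pos_def_fun_def)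
  show len: "b \<le> s + T" using b by (metis ereal_less_eq(3) min.cobounded1)
  have le_trig: "ereal b \<le> trigger_time F W a T s (x s)" unfolding b by simp
  have strict: "W (x t) \<le> ?c" if t: "t \<in> {s..<b}" for t
  proof (cases "x s = 0")
    case True
    have "x t = (\<lambda>_. 0) t"
      by (rule ode_solution_unique[OF lip x]) (use t True F0 in \<open>auto simp: ode_solution_def\<close>)
    then show ?thesis using True a0 by simp
  next
    case False
    show ?thesis
    proof (rule ccontr)
      assume "\<not> ?thesis"
      then have gt: "W (x t) > ?c" by simp
      have "continuous_on {s..t} (\<lambda>t. W (x t))" by (rule continuous_on_subset[OF Wx]) (use t in auto)
      from IVT'[OF _ _ _ this, of ?c] obtain u where u: "s \<le> u" "u \<le> t" "W (x u) = ?c"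
        using gt t apos[OF False] by auto
      then have "u \<noteq> s" using apos[OF False] by auto
      moreover have "ode_solution F {s..u} x" by (rule ode_solution_subset[OF x(1)]) (use u t in auto)
      ultimately have "u \<in> hitting_times F W s (x s) ?c"
        using u by (auto simp: hitting_times_def)
      from trigger_time_le[of "x s" u F W s a T, OF False this] le_trig have "ereal b \<le> ereal u"
        using order.trans by blast
      then show False using u t by auto
    qed
  qed
  show "W (x t) \<le> ?c" if "t \<in> {s..b}"
  proof (cases "t = b")
    case True
    have "(\<lambda>t. W (x t)) ` closure {s..<b} \<subseteq> {..?c}"
      by (rule image_closure_subset) (use sb strict Wx in auto)
    then show ?thesis using True sb by (auto simp: image_subset_iff)
  qed (use strict that in auto)
  assume lt: "b < s + T"
  have trig: "trigger_time F W a T s (x s) = ereal b"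
    using b lt by (auto simp: min_def split: if_splits)
  have ne: "x s \<noteq> 0" using trig lt by (auto simp: trigger_time_def)
  let ?H = "hitting_times F W s (x s) ?c"
  have inf: "(INF t\<in>?H. ereal t) = ereal b" using trig ne by (simp add: trigger_time_def)
  have "W (x b) = ?c"
  proof (rule ccontr)
    assume neq: "W (x b) \<noteq> ?c"
    have "?H \<noteq> {}" using inf by (metis image_empty Inf_empty top_ereal_def PInfty_neq_ereal(1))
    then obtain t1 where t1: "t1 \<in> ?H" by auto
    have ge: "b \<le> t" if "t \<in> ?H" for t
      using INF_lower[OF that, of ereal] unfolding inf by simp
    obtain y where y: "s < t1" "ode_solution F {s..t1} y" "W (y t1) = ?c"
      and yx: "\<And>r. r \<in> {s..min b t1} \<Longrightarrow> y r = x r"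
      using hitting_timesD[OF lip x refl t1] by metis
    have cy: "continuous_on {s..t1} y" by (rule ode_solution_continuous_on[OF y(2)])
    have Wy: "continuous_on {s..t1} (\<lambda>t. W (y t))"
      by (rule continuous_on_compose2[OF W cy]) auto
    have ys: "y s = x s" using yx[of s] y(1) sb by auto
    have yb: "y b = x b" using yx[of b] ge[OF t1] sb by auto
    have bt1: "b < t1" using ge[OF t1] neq yb y(3) by (cases "b = t1") auto
    \<comment> \<open>The infimum \<open>b\<close> is not attained, so hitting times accumulate at \<open>b\<close> from the right.\<close>
    have hit: "W (y t) = ?c" if t: "t \<in> ?H" "t \<le> t1" for t
    proof -
      obtain z where "W (z t) = ?c" "\<And>r. r \<in> {s..min t1 t} \<Longrightarrow> z r = y r" "s < t"
        using hitting_timesD[OF lip ode_solution_subset[OF y(2) ico_subset] cy ys t(1)] by metis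
      then show ?thesis using t by auto
    qed
    have "\<exists>d>0. \<forall>t\<in>{s..t1}. dist t b < d \<longrightarrow> dist (W (y t)) (W (y b)) < \<bar>W (x b) - ?c\<bar>"
      using Wy sb bt1 neq unfolding continuous_on_iff by (auto dest!: bspec[of _ _ b])
    then obtain d where d: "d > 0"
      "\<And>t. t \<in> {s..t1} \<Longrightarrow> dist t b < d \<Longrightarrow> dist (W (y t)) (W (y b)) < \<bar>W (x b) - ?c\<bar>" by blast
    have "(INF t\<in>?H. ereal t) < ereal (min (b + d) t1)" unfolding inf using d bt1 by simp
    then obtain t where t: "t \<in> ?H" "t < min (b + d) t1" unfolding INF_less_iff by auto
    show False
      using d(2)[of t] hit[OF t(1)] t ge[OF t(1)] sb yb by (auto simp: dist_real_def)
  qed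
  with ne show "x s \<noteq> 0 \<and> W (x b) = ?c" by simp
qed

text \<open>Provides the next event time in the construction of solutions. It exceeds
  \<open>s\<close> because \<open>W\<close> needs positive time to rise by
  \<open>a (y s) > 0\<close>, and it is at most \<open>e\<close> because a level reached at
  \<open>e\<close> has been crossed by then.\<close>

lemma trigger_exists:
  fixes F :: "'a::euclidean_space \<Rightarrow> 'a"
  assumes lip: "locally_lip F"
    and W: "continuous_on UNIV W" and a: "pos_def_fun a" and "T > 0"
    and y: "ode_solution F {s..e} y" and se: "s < e" "e \<le> s + T"
    and exit: "e = s + T \<or> y s \<noteq> 0 \<and> W (y e) \<ge> W (y s) + a (y s)"
  obtains b where "s < b" "b \<le> e" "ereal b = min (ereal (s + T)) (trigger_time F W a T s (y s))"
proof -
  let ?t = "trigger_time F W a T s (y s)" and ?c = "W (y s) + a (y s)"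
  let ?H = "hitting_times F W s (y s) ?c"
  have cy: "continuous_on {s..e} y" by (rule ode_solution_continuous_on[OF y])
  have Wy: "continuous_on {s..e} (\<lambda>t. W (y t))"
    by (rule continuous_on_compose2[OF W cy]) auto
  have apos: "\<And>x. x \<noteq> 0 \<Longrightarrow> a x > 0" using a by (auto simp: pos_def_fun_def)
  have upper: "min (ereal (s + T)) ?t \<le> ereal e"
  proof (cases "e = s + T")
    case False
    then have ne: "y s \<noteq> 0" and "W (y e) \<ge> ?c" using exit by auto
    from IVT'[OF _ this(2) _ Wy] obtain u where u: "s \<le> u" "u \<le> e" "W (y u) = ?c"
      using apos[OF ne] se by auto
    then have "u \<noteq> s" using apos[OF ne] by auto
    then have "u \<in> ?H" using u ode_solution_subset[OF y, of "{s..u}"] by (auto simp: hitting_times_def)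
    from trigger_time_le[of "y s" u F W s a T, OF ne this] u show ?thesis by (simp add: min.coboundedI2 order_trans)
  qed simp
  have lower: "ereal s < min (ereal (s + T)) ?t"
  proof (cases "y s = 0")
    case True
    then show ?thesis using \<open>T > 0\<close> by (simp add: trigger_time_def)
  next
    case False
    have "\<exists>d>0. \<forall>t\<in>{s..e}. dist t s < d \<longrightarrow> dist (W (y t)) (W (y s)) < a (y s)"
      using Wy se apos[OF False] unfolding continuous_on_iff by (auto dest!: bspec[of _ _ s])
    then obtain d where d: "d > 0"
      "\<And>t. t \<in> {s..e} \<Longrightarrow> dist t s < d \<Longrightarrow> dist (W (y t)) (W (y s)) < a (y s)" by blast
    have "s + min d (e - s) \<le> t" if t: "t \<in> ?H" for t
    proof (rule ccontr)
      assume *: "\<not> ?thesis"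
      obtain z where "W (z t) = ?c" "\<And>r. r \<in> {s..min e t} \<Longrightarrow> z r = y r" "s < t"
        using hitting_timesD[OF lip ode_solution_subset[OF y ico_subset] cy refl t]
        by metis
      then have "W (y t) = ?c" using * by auto
      then show False using d(2)[of t] * \<open>s < t\<close> apos[OF False]
        by (auto simp: dist_real_def min_def split: if_splits)
    qed
    then have "ereal (s + min d (e - s)) \<le> (INF t\<in>?H. ereal t)" by (intro INF_greatest) auto
    moreover have "ereal s < ereal (s + min d (e - s))" using d se by auto
    ultimately have "ereal s < (INF t\<in>?H. ereal t)" by (rule less_le_trans[rotated])
    then have "ereal s < ?t" using False by (simp add: trigger_time_def)
    then show ?thesis using \<open>T > 0\<close> by simp
  qed
  obtain b where b: "min (ereal (s + T)) ?t = ereal b"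
    using upper lower by (cases "min (ereal (s + T)) ?t") auto
  show thesis using that[of b] upper lower unfolding b by auto
qed

section \<open>Local Lipschitz continuity of smooth maps\<close>

text \<open>Relative to \<open>S\<close>, because \<open>k\<close> is given on
  \<open>\<Theta> \<times> UNIV\<close>, which need not be open.\<close>

definition local_lip_on :: "'a::real_normed_vector set \<Rightarrow> ('a \<Rightarrow> 'b::real_normed_vector) \<Rightarrow> bool"
  where "local_lip_on S h \<longleftrightarrow> (\<forall>x\<in>S. \<exists>e>0. \<exists>L. L-lipschitz_on (ball x e \<inter> S) h)"

lemma local_lip_on_continuous:
  assumes h: "local_lip_on S h"
  shows "continuous_on S h"
  unfolding continuous_on_iff
proof (intro ballI allI impI)
  fix x and d :: real assume x: "x \<in> S" and d: "d > 0"
  obtain e L where e: "e > 0" "L-lipschitz_on (ball x e \<inter> S) h"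
    using h x unfolding local_lip_on_def by blast
  have "continuous_on (ball x e \<inter> S) h" by (rule lipschitz_on_continuous_on[OF e(2)])
  moreover have "x \<in> ball x e \<inter> S" using x e by simp
  ultimately obtain d' where d': "d' > 0"
    "\<forall>y\<in>ball x e \<inter> S. dist y x < d' \<longrightarrow> dist (h y) (h x) < d"
    using d unfolding continuous_on_iff by blast
  show "\<exists>d'>0. \<forall>y\<in>S. dist y x < d' \<longrightarrow> dist (h y) (h x) < d"
    by (rule exI[of _ "min e d'"]) (use e d' in \<open>auto simp: dist_commute\<close>)
qed

lemma local_lip_on_compose:
  assumes h: "local_lip_on S h" and h': "local_lip_on S' h'" and sub: "h ` S \<subseteq> S'"
  shows "local_lip_on S (\<lambda>x. h' (h x))"
  unfolding local_lip_on_def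
proof
  fix x assume x: "x \<in> S"
  obtain e L where e: "e > 0" "L-lipschitz_on (ball x e \<inter> S) h"
    using h x unfolding local_lip_on_def by blast
  obtain e' L' where e': "e' > 0" "L'-lipschitz_on (ball (h x) e' \<inter> S') h'"
    using h' x sub unfolding local_lip_on_def by blast
  obtain d where d: "d > 0" "\<forall>y\<in>S. dist y x < d \<longrightarrow> dist (h y) (h x) < e'"
    using local_lip_on_continuous[OF h] x e' unfolding continuous_on_iff by blast
  have "L-lipschitz_on (ball x (min e d) \<inter> S) h"
    by (rule lipschitz_on_subset[OF e(2)]) auto
  moreover have "L'-lipschitz_on (h ` (ball x (min e d) \<inter> S)) h'"
    by (rule lipschitz_on_subset[OF e'(2)]) (use d sub in \<open>auto simp: dist_commute\<close>)
  ultimately have "(L' * L)-lipschitz_on (ball x (min e d) \<inter> S) (\<lambda>x. h' (h x))"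
    by (rule lipschitz_on_compose2)
  then show "\<exists>e>0. \<exists>L. L-lipschitz_on (ball x e \<inter> S) (\<lambda>x. h' (h x))"
    using e d by (intro exI[of _ "min e d"]) auto
qed

lemma local_lip_on_combine:
  assumes h: "local_lip_on S h" and h': "local_lip_on S h'"
    and op: "\<And>X L L'. L-lipschitz_on X h \<Longrightarrow> L'-lipschitz_on X h' \<Longrightarrow> \<exists>M. M-lipschitz_on X j"
  shows "local_lip_on S j"
  unfolding local_lip_on_def
proof
  fix x assume x: "x \<in> S"
  obtain e L where e: "e > 0" "L-lipschitz_on (ball x e \<inter> S) h"
    using h x unfolding local_lip_on_def by blast
  obtain e' L' where e': "e' > 0" "L'-lipschitz_on (ball x e' \<inter> S) h'"
    using h' x unfolding local_lip_on_def by blast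
  have "\<exists>M. M-lipschitz_on (ball x (min e e') \<inter> S) j"
    by (rule op) (rule lipschitz_on_subset[OF e(2)] lipschitz_on_subset[OF e'(2)]; auto)+
  then show "\<exists>e>0. \<exists>L. L-lipschitz_on (ball x e \<inter> S) j"
    using e e' by (intro exI[of _ "min e e'"]) auto
qed

lemma local_lip_on_add:
  "local_lip_on S h \<Longrightarrow> local_lip_on S h' \<Longrightarrow> local_lip_on S (\<lambda>x. h x + h' x)"
  by (rule local_lip_on_combine[of S h h']) (auto intro: lipschitz_on_add)

lemma local_lip_on_Pair:
  "local_lip_on S h \<Longrightarrow> local_lip_on S h' \<Longrightarrow> local_lip_on S (\<lambda>x. (h x, h' x))"
  by (rule local_lip_on_combine[of S h h']) (auto intro: lipschitz_on_Pair)

lemma lipschitz_imp_local_lip_on: "L-lipschitz_on S h \<Longrightarrow> local_lip_on S h"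
  unfolding local_lip_on_def by (meson inf_le2 lipschitz_on_subset zero_less_one)

lemma bounded_linear_local_lip_on: "bounded_linear h \<Longrightarrow> local_lip_on UNIV h"
  by (erule bounded_linear.lipschitz_boundE[of _ UNIV]) (rule lipschitz_imp_local_lip_on)

text \<open>Compactness of closed balls makes the local constants uniform. The singleton
  \<open>{0}\<close> is a dummy time domain, as \<open>local_lipschitz\<close> is a notion for
  time-dependent fields.\<close>

lemma local_lip_imp_locally_lip:
  fixes F :: "'a::euclidean_space \<Rightarrow> 'b::real_normed_vector"
  assumes "local_lip_on UNIV F"
  shows "locally_lip F"
  unfolding locally_lip_def
proof
  fix r :: real
  have "local_lipschitz {0::real} UNIV (\<lambda>_. F)"
  proof (rule local_lipschitzI)
    fix t x assume "t \<in> {0::real}"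
    obtain e L where e: "e > 0" "L-lipschitz_on (ball x e) F"
      using assms unfolding local_lip_on_def Int_UNIV_right by blast
    have "L-lipschitz_on (cball x (e/2)) F"
      by (rule lipschitz_on_subset[OF e(2)]) (use e in auto)
    then show "\<exists>u>0. \<exists>L. \<forall>t\<in>cball t u \<inter> {0}. L-lipschitz_on (cball x u \<inter> UNIV) F"
      using e by (intro exI[of _ "e/2"]) auto
  qed
  then have "local_lipschitz {0::real} (cball 0 r) (\<lambda>_. F)"
    by (rule local_lipschitz_subset) auto
  then obtain L where "\<And>t. t \<in> {0::real} \<Longrightarrow> L-lipschitz_on (cball 0 r) F"
    by (rule local_lipschitz_compact_implies_lipschitz) auto
  then show "\<exists>L. L-lipschitz_on (cball 0 r) F" by blast
qed

text \<open>\<open>Ck_on\<close> yields continuity of each directional derivative separately. On a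
  compact ball each of them is bounded, the bounds for the basis vectors add up to a bound on the
  operator norm, and the mean value inequality applies because balls are convex.\<close>

lemma Ck_on_1_lipschitz:
  fixes H :: "'a::euclidean_space \<Rightarrow> 'b::real_normed_vector"
  assumes U: "open U" "x \<in> U" and H: "Ck_on 1 U H"
  shows "\<exists>e>0. \<exists>L. L-lipschitz_on (ball x e) H"
proof -
  obtain e where e: "e > 0" "cball x e \<subseteq> U" using U open_contains_cball by blast
  let ?D = "\<lambda>y. frechet_derivative H (at y)"
  have D: "(H has_derivative ?D y) (at y)" if "y \<in> U" for y
    using H that by (auto simp: frechet_derivative_works)
  have cont: "continuous_on (cball x e) (\<lambda>y. ?D y v)" for v
    using H e(2) by (auto intro: continuous_on_subset)
  have "\<exists>B. \<forall>y\<in>cball x e. norm (?D y v) \<le> B" for v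
  proof -
    have "bounded ((\<lambda>y. ?D y v) ` cball x e)"
      by (intro compact_imp_bounded compact_continuous_image cont) auto
    then show ?thesis by (auto simp: bounded_iff)
  qed
  then obtain B where B: "\<And>v y. y \<in> cball x e \<Longrightarrow> norm (?D y v) \<le> B v" by metis
  define L where "L = (\<Sum>b\<in>Basis. B b)"
  have onorm: "onorm (?D y) \<le> L" if y: "y \<in> cball x e" for y
  proof (rule onorm_le)
    fix v
    have lin: "linear (?D y)" using D[of y] y e(2) has_derivative_linear by blast
    have "?D y v = ?D y (\<Sum>b\<in>Basis. (v \<bullet> b) *\<^sub>R b)" by (simp add: euclidean_representation)
    also have "\<dots> = (\<Sum>b\<in>Basis. (v \<bullet> b) *\<^sub>R ?D y b)"
      by (simp add: linear_sum[OF lin] linear_scale[OF lin])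
    also have "norm \<dots> \<le> (\<Sum>b\<in>Basis. norm ((v \<bullet> b) *\<^sub>R ?D y b))" by (rule norm_sum)
    also have "\<dots> \<le> (\<Sum>b\<in>Basis. norm v * B b)"
      by (intro sum_mono) (auto intro!: mult_mono B y Basis_le_norm)
    finally show "norm (?D y v) \<le> L * norm v" by (simp add: L_def sum_distrib_left mult.commute)
  qed
  have L0: "0 \<le> L" using onorm[of x] onorm_pos_le[OF has_derivative_bounded_linear[OF D[of x]]] e U
    by auto
  have "L-lipschitz_on (cball x e) H"
  proof (rule lipschitz_onI[OF _ L0])
    fix y z assume yz: "y \<in> cball x e" "z \<in> cball x e"
    show "dist (H y) (H z) \<le> L * dist y z"
      unfolding dist_norm
      by (rule differentiable_bound[OF convex_cball _ onorm yz])
        (use D e(2) in \<open>blast intro: has_derivative_at_withinI\<close>)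
  qed
  then show ?thesis using e lipschitz_on_subset[OF _ ball_subset_cball] by blast
qed

lemma smooth_map_on_local_lip:
  fixes h :: "'a::euclidean_space \<Rightarrow> 'b::real_normed_vector"
  assumes "smooth_map_on S h"
  shows "local_lip_on S h"
  unfolding local_lip_on_def
proof
  fix x assume "x \<in> S"
  with assms[unfolded smooth_map_on_def]
  have "\<exists>U H. open U \<and> x \<in> U \<and> (\<forall>j. Ck_on j U H) \<and> (\<forall>y\<in>U \<inter> S. H y = h y)"
    by (rule bspec)
  then obtain U H where U: "open U" "x \<in> U" "\<forall>j. Ck_on j U H" "\<forall>y\<in>U \<inter> S. H y = h y"
    by (elim exE conjE)
  obtain e L where e: "e > 0" "L-lipschitz_on (ball x e) H"
    using Ck_on_1_lipschitz[OF U(1,2) U(3)[rule_format, of 1]] by blast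
  obtain e' where e': "e' > 0" "ball x e' \<subseteq> U" using U open_contains_ball by blast
  have "L-lipschitz_on (ball x (min e e') \<inter> S) H"
    by (rule lipschitz_on_subset[OF e(2)]) auto
  then have "L-lipschitz_on (ball x (min e e') \<inter> S) h"
    by (rule lipschitz_on_transform) (use e' U(4) in auto)
  then show "\<exists>e>0. \<exists>L. L-lipschitz_on (ball x e \<inter> S) h"
    using e e' by (intro exI[of _ "min e e'"]) auto
qed

lemma bounded_linear_matrix_vector_mult_left: "bounded_linear (\<lambda>A :: real^'l^'n. A *v v)"
  unfolding linear_conv_bounded_linear[symmetric]
  by (rule linearI) (simp_all add: matrix_vector_mult_add_rdistrib scaleR_matrix_vector_assoc)

lemma locally_lip_loop_field:
  fixes f :: "(real^'n) \<times> (real^'m) \<Rightarrow> real^'n"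
    and g :: "(real^'n) \<times> (real^'m) \<Rightarrow> real^'l^'n"
    and k :: "(real^'l) \<times> (real^'n) \<Rightarrow> real^'m"
  assumes f: "smooth_map_on UNIV f" and g: "smooth_map_on UNIV g"
    and k: "smooth_map_on (\<Theta> \<times> UNIV) k" and \<eta>: "\<eta> \<in> \<Theta>"
  shows "locally_lip (loop_field f g k \<theta> \<eta>)"
proof -
  have id: "local_lip_on UNIV (\<lambda>x :: real^'n. x)"
    by (rule lipschitz_imp_local_lip_on) (rule lipschitz_on_id)
  have const: "local_lip_on UNIV (\<lambda>x :: real^'n. \<eta>)"
    by (rule lipschitz_imp_local_lip_on) (rule lipschitz_on_constant)
  have "local_lip_on UNIV (\<lambda>x. k (\<eta>, x))"
    by (rule local_lip_on_compose[OF local_lip_on_Pair[OF const id] smooth_map_on_local_lip[OF k]])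
      (use \<eta> in auto)
  note xu = local_lip_on_Pair[OF id this]
  have fl: "local_lip_on UNIV (\<lambda>x. f (x, k (\<eta>, x)))"
    by (rule local_lip_on_compose[OF xu smooth_map_on_local_lip[OF f]]) auto
  have "local_lip_on UNIV (\<lambda>x. g (x, k (\<eta>, x)))"
    by (rule local_lip_on_compose[OF xu smooth_map_on_local_lip[OF g]]) auto
  then have gl: "local_lip_on UNIV (\<lambda>x. g (x, k (\<eta>, x)) *v \<theta>)"
    by (rule local_lip_on_compose[OF _ bounded_linear_local_lip_on[OF bounded_linear_matrix_vector_mult_left]]) auto
  show ?thesis
    using local_lip_imp_locally_lip[OF local_lip_on_add[OF fl gl]]
    by (simp add: loop_field_def[abs_def])
qed

section \<open>The normal equations\<close>

lemma interval_integral_continuous: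
  fixes h :: "real \<Rightarrow> 'a::euclidean_space"
  assumes "continuous_on {a..b} h" "a \<le> b"
  shows "(LBINT t=ereal a..ereal b. h t) = integral {a..b} h"
  using assms by (intro interval_integral_eq_integral borel_integrable_atLeastAtMost') auto

lemma continuous_on_section:
  assumes "continuous_on (A \<times> B) (\<lambda>(t, s). h t s)" "t \<in> A"
  shows "continuous_on B (h t)"
proof -
  have "continuous_on B (\<lambda>s. (\<lambda>(t, s). h t s) (t, s))"
    by (rule continuous_on_compose2[OF assms(1)]) (use assms(2) in \<open>auto intro!: continuous_intros\<close>)
  then show ?thesis by simp
qed

lemma continuous_on_integral_section:
  fixes h :: "real \<Rightarrow> real \<Rightarrow> 'a::banach"
  assumes "continuous_on ({a..b} \<times> {a..b}) (\<lambda>(t, s). h t s)"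
  shows "continuous_on {a..b} (\<lambda>t. integral {a..b} (h t))"
  using integral_continuous_on_param[of "{a..b}" a b h] assms by simp

text \<open>The integrand \<open>h'\<close> has to agree with the continuous \<open>h\<close> on the
  square only: for \<open>lsq_p\<close> and \<open>lsq_q\<close> a continuous expression is
  available just for times within the trajectory.\<close>

lemma iterated_interval_integral:
  fixes h h' :: "real \<Rightarrow> real \<Rightarrow> 'a::euclidean_space"
  assumes h: "continuous_on ({a..b} \<times> {a..b}) (\<lambda>(t, s). h t s)" and "a \<le> b"
    and eq: "\<And>t s. t \<in> {a..b} \<Longrightarrow> s \<in> {a..b} \<Longrightarrow> h' t s = h t s"
  shows "(LBINT t=ereal a..ereal b. (LBINT s=ereal a..ereal b. h' t s)) =
    integral {a..b} (\<lambda>t. integral {a..b} (h t))"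
proof -
  have "(LBINT t=ereal a..ereal b. (LBINT s=ereal a..ereal b. h' t s)) =
      (LBINT t=ereal a..ereal b. integral {a..b} (h t))"
  proof (rule interval_integral_cong)
    fix t assume "t \<in> einterval (min (ereal a) (ereal b)) (max (ereal a) (ereal b))"
    then have t: "t \<in> {a..b}" using \<open>a \<le> b\<close> by (auto simp: einterval_iff min_def max_def)
    have "(LBINT s=ereal a..ereal b. h' t s) = (LBINT s=ereal a..ereal b. h t s)"
      by (rule interval_integral_cong)
        (use t eq \<open>a \<le> b\<close> in \<open>auto simp: einterval_iff min_def max_def\<close>)
    also have "\<dots> = integral {a..b} (h t)"
      by (rule interval_integral_continuous[OF continuous_on_section[OF h t] \<open>a \<le> b\<close>])
    finally show "(LBINT s=ereal a..ereal b. h' t s) = integral {a..b} (h t)" .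
  qed
  also have "\<dots> = integral {a..b} (\<lambda>t. integral {a..b} (h t))"
    by (rule interval_integral_continuous[OF continuous_on_integral_section[OF h] \<open>a \<le> b\<close>])
  finally show ?thesis .
qed

lemma integral_bounded_linear_twice:
  fixes h :: "real \<Rightarrow> real \<Rightarrow> 'a::euclidean_space" and l :: "'a \<Rightarrow> 'b::euclidean_space"
  assumes h: "continuous_on ({a..b} \<times> {a..b}) (\<lambda>(t, s). h t s)" and l: "bounded_linear l"
  shows "integral {a..b} (\<lambda>t. integral {a..b} (\<lambda>s. l (h t s))) =
    l (integral {a..b} (\<lambda>t. integral {a..b} (h t)))"
proof -
  have "integral {a..b} (\<lambda>s. l (h t s)) = l (integral {a..b} (h t))" if "t \<in> {a..b}" for t
    using integral_linear[OF integrable_continuous_real[OF continuous_on_section[OF h that]] l]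
    by (simp add: o_def)
  then have "integral {a..b} (\<lambda>t. integral {a..b} (\<lambda>s. l (h t s))) =
      integral {a..b} (\<lambda>t. l (integral {a..b} (h t)))"
    by (rule Henstock_Kurzweil_Integration.integral_cong)
  also have "\<dots> = l (integral {a..b} (\<lambda>t. integral {a..b} (h t)))"
    using integral_linear[OF integrable_continuous_real[OF continuous_on_integral_section[OF h]] l]
    by (simp add: o_def)
  finally show ?thesis .
qed

lemma continuous_on_matrix_vector_mult:
  fixes A :: "'a::topological_space \<Rightarrow> real^'l^'n"
  assumes "continuous_on S A" "continuous_on S v"
  shows "continuous_on S (\<lambda>x. A x *v v x)"
  unfolding matrix_vector_mult_def
  by (intro continuous_on_vec_lambda continuous_intros continuous_on_component assms)

lemma inner_gram_matrix: "v \<bullet> ((transpose M ** M) *v v) = (norm (M *v v))\<^sup>2"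
  for M :: "real^'l^'n"
proof -
  have "v \<bullet> ((transpose M ** M) *v v) = ((M *v v) v* M) \<bullet> v"
    by (simp add: transpose_matrix_vector inner_commute flip: matrix_vector_mul_assoc)
  also have "\<dots> = (M *v v) \<bullet> (M *v v)" by (rule dot_lmul_matrix)
  finally show ?thesis by (simp add: power2_norm_eq_inner)
qed

text \<open>Pairing the Gram matrix with \<open>\<zeta> - \<theta>\<close> gives the integral of
  \<open>(norm (q t s *v (\<zeta> - \<theta>)))\<^sup>2\<close>, whose integrand is continuous and non-negative.\<close>

lemma normal_equation_iff:
  fixes Q :: "real \<Rightarrow> real^'l^'n"
  assumes b: "b > 0" and Q: "continuous_on {0..b} Q"
    and q: "\<And>t s. t \<in> {0..b} \<Longrightarrow> s \<in> {0..b} \<Longrightarrow> q t s = Q t - Q s"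
    and p: "\<And>t s. t \<in> {0..b} \<Longrightarrow> s \<in> {0..b} \<Longrightarrow> p t s = q t s *v \<theta>"
  shows "(LBINT t=ereal 0..ereal b. (LBINT s=ereal 0..ereal b. transpose (q t s) *v p t s)) =
      (LBINT t=ereal 0..ereal b. (LBINT s=ereal 0..ereal b. transpose (q t s) ** q t s)) *v \<zeta>
    \<longleftrightarrow> (\<forall>t\<in>{0..b}. \<forall>s\<in>{0..b}. (Q t - Q s) *v (\<zeta> - \<theta>) = 0)"
    (is "?L = ?R \<longleftrightarrow> ?Z")
proof -
  define A where "A t s = transpose (Q t - Q s) ** (Q t - Q s)" for t s
  define J where "J = integral {0..b} (\<lambda>t. integral {0..b} (A t))"
  let ?S = "{0..b} \<times> {0..b}"
  have c1: "continuous_on ?S (\<lambda>z. Q (fst z) - Q (snd z))"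
    by (intro continuous_intros continuous_on_compose2[OF Q]) auto
  have cA: "continuous_on ?S (\<lambda>(t, s). A t s)"
    unfolding A_def split_beta matrix_matrix_mult_def transpose_def
    by (simp del: vector_minus_component,
        intro continuous_on_vec_lambda continuous_intros continuous_on_component c1)
  have lin: "bounded_linear (\<lambda>M :: real^'l^'l. M *v v)" for v
    by (rule bounded_linear_matrix_vector_mult_left)
  have cAv: "continuous_on ?S (\<lambda>(t, s). A t s *v v)" for v
    using continuous_on_matrix_vector_mult[OF cA continuous_on_const[of _ v]] by (simp add: split_beta)
  have Av: "integral {0..b} (\<lambda>t. integral {0..b} (\<lambda>s. A t s *v v)) = J *v v" for v
    unfolding J_def by (rule integral_bounded_linear_twice[OF cA lin])
  \<comment> \<open>As \<open>p\<close> is \<open>q\<close> applied to the true parameter, both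
    sides of the normal equation involve the same matrix \<open>J\<close>, and the equation becomes
    \<open>J *v (\<zeta> - \<theta>) = 0\<close>.\<close>
  have L: "?L = J *v \<theta>"
    unfolding Av[symmetric]
    by (rule iterated_interval_integral[OF cAv])
      (use b in \<open>auto simp: A_def p q simp flip: matrix_vector_mul_assoc\<close>)
  have R: "?R = J *v \<zeta>"
    unfolding J_def by (subst iterated_interval_integral[OF cA]) (use b in \<open>auto simp: A_def q\<close>)
  have E: "J *v \<theta> = J *v \<zeta> \<longleftrightarrow> J *v (\<zeta> - \<theta>) = 0"
    by (auto simp: matrix_vector_mult_diff_distrib)
  have Z: "J *v (\<zeta> - \<theta>) = 0 \<longleftrightarrow> ?Z"
  proof
    assume J: "J *v (\<zeta> - \<theta>) = 0"
    let ?N = "\<lambda>t s. (norm ((Q t - Q s) *v (\<zeta> - \<theta>)))\<^sup>2"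
    have N: "?N t s = (\<zeta> - \<theta>) \<bullet> (A t s *v (\<zeta> - \<theta>))" for t s
      by (simp add: A_def inner_gram_matrix)
    have cN: "continuous_on ?S (\<lambda>(t, s). ?N t s)"
      unfolding N using cAv[of "\<zeta> - \<theta>"] by (auto simp: split_beta intro!: continuous_intros)
    have "integral {0..b} (\<lambda>t. integral {0..b} (?N t)) = (\<zeta> - \<theta>) \<bullet> (J *v (\<zeta> - \<theta>))"
      unfolding N Av[symmetric]
      by (rule integral_bounded_linear_twice[OF cAv bounded_linear_inner_right])
    then have zero: "integral {0..b} (\<lambda>t. integral {0..b} (?N t)) = 0" using J by simp
    have "integral {0..b} (?N t) = 0" if "t \<in> {0..b}" for t
      using integral_eq_0_iff[OF continuous_on_integral_section[OF cN] b] zero that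
      by (simp add: integral_nonneg integrable_continuous_real[OF continuous_on_section[OF cN]])
    then have "?N t s = 0" if "t \<in> {0..b}" "s \<in> {0..b}" for t s
      using integral_eq_0_iff[OF continuous_on_section[OF cN that(1)] b] that by simp
    then show ?Z by simp
  next
    assume Z: ?Z
    have "J *v (\<zeta> - \<theta>) = integral {0..b} (\<lambda>t. integral {0..b} (\<lambda>s. 0 :: real^'l))"
      unfolding Av[symmetric]
      by (intro Henstock_Kurzweil_Integration.integral_cong)
        (use Z in \<open>auto simp: A_def simp flip: matrix_vector_mul_assoc\<close>)
    then show "J *v (\<zeta> - \<theta>) = 0" by simp
  qed
  show ?thesis
    by (rule trans[OF arg_cong2[where f="(=)", OF L R] trans[OF E Z]])
qed

text \<open>The input jumps at event times, so integrands along a trajectory are only piecewise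
  continuous: on each half-open piece they coincide with a function that is continuous up to the
  right end.\<close>

lemma set_integrable_glue:
  fixes h :: "real \<Rightarrow> 'a::euclidean_space"
  assumes "\<And>i. i < n \<Longrightarrow> \<tau> i < \<tau> (Suc i)"
    and "\<And>i. i < n \<Longrightarrow> \<exists>h'. continuous_on {\<tau> i..\<tau> (Suc i)} h' \<and> (\<forall>r\<in>{\<tau> i..<\<tau> (Suc i)}. h r = h' r)"
  shows "\<tau> 0 \<le> \<tau> n \<and> set_integrable lborel {\<tau> 0..\<tau> n} h"
  using assms
proof (induction n)
  case 0
  have "continuous_on {\<tau> 0..\<tau> 0} h" by simp
  from borel_integrable_atLeastAtMost'[OF this] show ?case by auto
next
  case (Suc n)
  have IH: "\<tau> 0 \<le> \<tau> n" "set_integrable lborel {\<tau> 0..\<tau> n} h" using Suc by auto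
  have lt: "\<tau> n < \<tau> (Suc n)" using Suc.prems(1)[of n] by simp
  obtain h' where h': "continuous_on {\<tau> n..\<tau> (Suc n)} h'" "\<forall>r\<in>{\<tau> n..<\<tau> (Suc n)}. h r = h' r"
    using Suc.prems(2)[of n] by auto
  have "set_integrable lborel {\<tau> n..\<tau> (Suc n)} h'" by (rule borel_integrable_atLeastAtMost'[OF h'(1)])
  then have "set_integrable lborel {\<tau> n..<\<tau> (Suc n)} h'" by (rule set_integrable_subset) auto
  then have "set_integrable lborel {\<tau> n..<\<tau> (Suc n)} h"
    using h'(2) by (subst set_integrable_cong[of lborel lborel _ _ h h']) auto
  \<comment> \<open>The last end point is added as a degenerate interval, on which every function is
    continuous.\<close>
  moreover have "continuous_on {\<tau> (Suc n)..\<tau> (Suc n)} h" by simp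
  then have "set_integrable lborel {\<tau> (Suc n)} h"
    using borel_integrable_atLeastAtMost'[of "\<tau> (Suc n)" "\<tau> (Suc n)" h]
    by (simp only: atLeastAtMost_singleton)
  ultimately have "set_integrable lborel ({\<tau> 0..\<tau> n} \<union> ({\<tau> n..<\<tau> (Suc n)} \<union> {\<tau> (Suc n)})) h"
    using IH by (intro set_integrable_Un) auto
  moreover have "{\<tau> 0..\<tau> n} \<union> ({\<tau> n..<\<tau> (Suc n)} \<union> {\<tau> (Suc n)}) = {\<tau> 0..\<tau> (Suc n)}"
    using IH lt by auto
  ultimately show ?case using IH lt by simp
qed

text \<open>One formula for both orientations; it brings \<open>lsq_q\<close> into the form
  \<open>Q t - Q s\<close> required by \<open>normal_equation_iff\<close>.\<close>

lemma interval_integral_diff: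
  fixes h :: "real \<Rightarrow> 'a::euclidean_space"
  assumes h: "set_integrable lborel {a..b} h" and st: "s \<in> {a..b}" "t \<in> {a..b}"
  shows "(LBINT r=ereal s..ereal t. h r) = integral {a..t} h - integral {a..s} h"
proof -
  have *: "(LBINT r=ereal s..ereal t. h r) = integral {a..t} h - integral {a..s} h"
    if st: "s \<in> {a..b}" "t \<in> {a..b}" "s \<le> t" for s t
  proof -
    have sub: "set_integrable lborel S h" if "S \<subseteq> {a..b}" "S \<in> sets lborel" for S
      using set_integrable_subset[OF h that(2,1)] .
    have "(LBINT r=ereal s..ereal t. h r) = integral {s..t} h"
      by (rule interval_integral_eq_integral[OF st(3) sub]) (use st in auto)
    moreover have "h integrable_on {a..t}"
      by (rule set_borel_integral_eq_integral(1)[OF sub]) (use st in auto)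
    then have "integral {a..s} h + integral {s..t} h = integral {a..t} h"
      by (rule Henstock_Kurzweil_Integration.integral_combine[rotated 2]) (use st in auto)
    ultimately show ?thesis by (simp add: algebra_simps)
  qed
  show ?thesis
  proof (cases "s \<le> t")
    case False
    then show ?thesis
      using *[OF st(2,1)] interval_integral_endpoints_reverse[of "ereal s" "ereal t" h] by simp
  qed (use * st in auto)
qed

lemma lsq_p_cong:
  assumes "\<And>r. r \<in> {0<..<b} \<Longrightarrow> x r = x' r \<and> u r = u' r" and "t \<in> {0<..<b}" "s \<in> {0<..<b}"
  shows "lsq_p f x u t s = lsq_p f x' u' t s"
proof -
  have "(LBINT r=ereal s..ereal t. f (x r, u r)) = (LBINT r=ereal s..ereal t. f (x' r, u' r))"
    using assms by (intro interval_integral_cong) (auto simp: einterval_iff min_def max_def split: if_splits)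
  then show ?thesis using assms by (simp add: lsq_p_def)
qed

lemma lsq_q_cong:
  assumes "\<And>r. r \<in> {0<..<b} \<Longrightarrow> x r = x' r \<and> u r = u' r" and "t \<in> {0<..<b}" "s \<in> {0<..<b}"
  shows "lsq_q g x u t s = lsq_q g x' u' t s"
  unfolding lsq_q_def
  using assms by (intro interval_integral_cong) (auto simp: einterval_iff min_def max_def split: if_splits)

text \<open>Agreement at the end point \<open>b\<close> is not asked for. This matters because the
  input at \<open>b\<close> already uses the new estimate, which is itself defined through this
  feasible set.\<close>

lemma lsq_feasible_cong:
  assumes b: "0 \<le> b" and eq: "\<And>r. r \<in> {0<..<b} \<Longrightarrow> x r = x' r \<and> u r = u' r"
  shows "lsq_feasible \<Theta> f g x u b = lsq_feasible \<Theta> f g x' u' b"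
proof -
  have I: "r \<in> {0<..<b}" if "r \<in> einterval (min (ereal 0) (ereal b)) (max (ereal 0) (ereal b))" for r
    using that b by (auto simp: einterval_iff min_def max_def)
  have p: "lsq_p f x u t s = lsq_p f x' u' t s" if "t \<in> {0<..<b}" "s \<in> {0<..<b}" for t s
    by (rule lsq_p_cong[OF eq that])
  have q: "lsq_q g x u t s = lsq_q g x' u' t s" if "t \<in> {0<..<b}" "s \<in> {0<..<b}" for t s
    by (rule lsq_q_cong[OF eq that])
  have 1: "(LBINT t=ereal 0..ereal b. (LBINT s=ereal 0..ereal b.
        transpose (lsq_q g x u t s) *v lsq_p f x u t s)) =
      (LBINT t=ereal 0..ereal b. (LBINT s=ereal 0..ereal b.
        transpose (lsq_q g x' u' t s) *v lsq_p f x' u' t s))"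
    by (intro interval_integral_cong) (auto dest!: I simp: p q)
  have 2: "(LBINT t=ereal 0..ereal b. (LBINT s=ereal 0..ereal b.
        transpose (lsq_q g x u t s) ** lsq_q g x u t s)) =
      (LBINT t=ereal 0..ereal b. (LBINT s=ereal 0..ereal b.
        transpose (lsq_q g x' u' t s) ** lsq_q g x' u' t s))"
    by (intro interval_integral_cong) (auto dest!: I simp: q)
  show ?thesis unfolding lsq_feasible_def 1 2 ..
qed

section \<open>Least squares as projection onto a closed convex set\<close>

lemma is_arg_min_norm_iff:
  "is_arg_min (\<lambda>\<zeta>. (norm (\<zeta> - \<eta>))\<^sup>2) (\<lambda>y. y \<in> S) z \<longleftrightarrow>
    z \<in> S \<and> (\<forall>y\<in>S. norm (z - \<eta>) \<le> norm (y - \<eta>))"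
proof -
  have "(norm (y - \<eta>))\<^sup>2 < (norm (z - \<eta>))\<^sup>2 \<longleftrightarrow> \<not> norm (z - \<eta>) \<le> norm (y - \<eta>)" for y
    by (simp add: power_mono_iff flip: not_le)
  then show ?thesis unfolding is_arg_min_def by blast
qed

lemma is_unique_arg_minD:
  assumes "is_unique_arg_min (\<lambda>\<zeta>. (norm (\<zeta> - \<eta>))\<^sup>2) S z"
  shows "z \<in> S" "y \<in> S \<Longrightarrow> norm (z - \<eta>) \<le> norm (y - \<eta>)"
  using assms unfolding is_unique_arg_min_def is_arg_min_norm_iff by blast+

lemma is_unique_arg_min_unique:
  "is_unique_arg_min J S y \<Longrightarrow> is_unique_arg_min J S z \<Longrightarrow> y = z"
  unfolding is_unique_arg_min_def by blast

lemma is_unique_arg_min_closest_point: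
  fixes S :: "'a::euclidean_space set"
  assumes "convex S" "closed S" "S \<noteq> {}"
  shows "is_unique_arg_min (\<lambda>\<zeta>. (norm (\<zeta> - \<eta>))\<^sup>2) S (closest_point S \<eta>)"
proof -
  have le: "\<forall>y\<in>S. norm (closest_point S \<eta> - \<eta>) \<le> norm (y - \<eta>)"
    using closest_point_le[OF assms(2), of _ \<eta>] by (simp add: dist_norm norm_minus_commute)
  have unique: "y = closest_point S \<eta>" if "y \<in> S" "\<forall>z\<in>S. norm (y - \<eta>) \<le> norm (z - \<eta>)" for y
    by (rule closest_point_unique[OF assms(1,2) that(1)])
      (use that(2) in \<open>simp add: dist_norm norm_minus_commute\<close>)
  show ?thesis
    unfolding is_unique_arg_min_def is_arg_min_norm_iff
    using le unique closest_point_in_set[OF assms(2,3), of \<eta>] by blast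
qed

text \<open>The projection onto \<open>S\<close> is nonexpansive and fixes \<open>\<theta>\<close>,
  so replacing \<open>\<eta>\<close> by its projection cannot increase the parameter error.\<close>

lemma projection_contracts:
  fixes S :: "'a::euclidean_space set"
  assumes S: "convex S" "closed S" "\<theta> \<in> S"
    and z: "is_unique_arg_min (\<lambda>\<zeta>. (norm (\<zeta> - \<eta>))\<^sup>2) S z"
  shows "norm (z - \<theta>) \<le> norm (\<eta> - \<theta>)"
proof -
  have "z = closest_point S \<eta>"
    using is_unique_arg_min_unique[OF z is_unique_arg_min_closest_point] S by blast
  moreover have "closest_point S \<theta> = \<theta>" using S by (simp add: closest_point_self)
  moreover have "S \<noteq> {}" using S by auto
  ultimately show ?thesis
    using closest_point_lipschitz[of S \<eta> \<theta>] S by (simp add: dist_norm)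
qed

lemma strict_mono_cover:
  fixes \<tau> :: "nat \<Rightarrow> real"
  assumes "\<tau> 0 \<le> t" "t < \<tau> n"
  obtains i where "i < n" "\<tau> i \<le> t" "t < \<tau> (Suc i)"
proof -
  have "\<exists>i<n. \<tau> i \<le> t \<and> t < \<tau> (Suc i)"
    using assms
  proof (induction n)
    case (Suc n)
    then show ?case by (cases "t < \<tau> n") (auto intro: less_SucI)
  qed simp
  then show thesis using that by blast
qed

section \<open>Finitely many steps of the hybrid system\<close>

locale adaptive_loop =
  fixes \<Theta> :: "(real^'l) set"
    and f :: "(real^'n) \<times> (real^'m) \<Rightarrow> real^'n"
    and g :: "(real^'n) \<times> (real^'m) \<Rightarrow> real^'l^'n"
    and k :: "(real^'l) \<times> (real^'n) \<Rightarrow> real^'m"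
    and V :: "(real^'l) \<times> (real^'n) \<Rightarrow> real"
    and a :: "real^'n \<Rightarrow> real"
    and T :: real and \<theta> :: "real^'l"
  assumes closed_\<Theta>: "closed \<Theta>" and convex_\<Theta>: "convex \<Theta>" and \<theta>: "\<theta> \<in> \<Theta>"
    and f: "continuous_on UNIV f" and g: "continuous_on UNIV g"
    and k: "continuous_on (\<Theta> \<times> UNIV) k"
    and lip: "\<eta> \<in> \<Theta> \<Longrightarrow> locally_lip (loop_field f g k \<theta> \<eta>)"
    and equilibrium: "\<eta> \<in> \<Theta> \<Longrightarrow> loop_field f g k \<theta> \<eta> 0 = 0"
    and V: "\<eta> \<in> \<Theta> \<Longrightarrow> continuous_on UNIV (\<lambda>y. V (\<eta>, y))"
    and a: "pos_def_fun a" and T: "T > 0"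
begin

text \<open>Contains neither the trigger nor the least-squares condition, and leaves the estimate at
  \<open>\<tau> n\<close> free: the feasible set has to be computed along a trajectory before that
  estimate can be chosen.\<close>

definition trajectory :: "nat \<Rightarrow> (real \<Rightarrow> real^'n) \<Rightarrow> (real \<Rightarrow> real^'l) \<Rightarrow> (nat \<Rightarrow> real) \<Rightarrow> bool"
  where "trajectory n x \<theta>h \<tau> \<longleftrightarrow>
    \<tau> 0 = 0 \<and> (\<forall>i<n. \<tau> i < \<tau> (Suc i)) \<and> continuous_on {0..\<tau> n} x \<and> (\<forall>i<n. \<theta>h (\<tau> i) \<in> \<Theta>) \<and>
    (\<forall>i<n. \<forall>t\<in>{\<tau> i..<\<tau> (Suc i)}. \<theta>h t = \<theta>h (\<tau> i)) \<and>
    (\<forall>i<n. ode_solution (loop_field f g k \<theta> (\<theta>h (\<tau> i))) {\<tau> i..<\<tau> (Suc i)} x)"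

definition partial_sol :: "nat \<Rightarrow> (real \<Rightarrow> real^'n) \<Rightarrow> (real \<Rightarrow> real^'l) \<Rightarrow> (nat \<Rightarrow> real) \<Rightarrow> bool"
  where "partial_sol n x \<theta>h \<tau> \<longleftrightarrow>
    trajectory n x \<theta>h \<tau> \<and> (\<forall>i\<le>n. \<theta>h (\<tau> i) \<in> \<Theta>) \<and>
    (\<forall>i<n. ereal (\<tau> (Suc i)) =
       min (ereal (\<tau> i + T))
         (trigger_time (loop_field f g k \<theta> (\<theta>h (\<tau> i))) (\<lambda>y. V (\<theta>h (\<tau> i), y)) a T (\<tau> i) (x (\<tau> i)))) \<and>
    (\<forall>i<n. is_unique_arg_min (\<lambda>\<zeta>. (norm (\<zeta> - \<theta>h (\<tau> i)))\<^sup>2)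
       (lsq_feasible \<Theta> f g x (\<lambda>t. k (\<theta>h t, x t)) (\<tau> (Suc i))) (\<theta>h (\<tau> (Suc i))))"

text \<open>This is the space N of the overview. The interval is open at \<open>b\<close>, so that
  the space depends on past estimates only and not on the one chosen at \<open>b\<close>.\<close>

definition unexcited :: "(real \<Rightarrow> real^'n) \<Rightarrow> (real \<Rightarrow> real^'l) \<Rightarrow> real \<Rightarrow> (real^'l) set"
  where "unexcited x \<theta>h b = {v. \<forall>r\<in>{0..<b}. g (x r, k (\<theta>h r, x r)) *v v = 0}"

lemma subspace_unexcited: "subspace (unexcited x \<theta>h b)"
  by (auto simp: subspace_def unexcited_def matrix_vector_right_distrib matrix_vector_mult_scaleR)

lemma unexcited_antimono: "b \<le> c \<Longrightarrow> unexcited x \<theta>h c \<subseteq> unexcited x \<theta>h b"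
  by (auto simp: unexcited_def)

text \<open>The conjunct \<open>\<theta>h t = \<theta>h (\<tau> i)\<close> loops as a rewrite rule, so \<open>trajectory_def\<close> is not for the simplifier.\<close>

lemma trajectoryD:
  assumes "trajectory n x \<theta>h \<tau>"
  shows "\<tau> 0 = 0" and "i < n \<Longrightarrow> \<tau> i < \<tau> (Suc i)" and "continuous_on {0..\<tau> n} x"
    and "i < n \<Longrightarrow> \<theta>h (\<tau> i) \<in> \<Theta>" and "i < n \<Longrightarrow> t \<in> {\<tau> i..<\<tau> (Suc i)} \<Longrightarrow> \<theta>h t = \<theta>h (\<tau> i)"
    and "i < n \<Longrightarrow> ode_solution (loop_field f g k \<theta> (\<theta>h (\<tau> i))) {\<tau> i..<\<tau> (Suc i)} x"
  using assms unfolding trajectory_def by blast+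

lemma partial_solD:
  assumes "partial_sol n x \<theta>h \<tau>"
  shows "trajectory n x \<theta>h \<tau>" and "i \<le> n \<Longrightarrow> \<theta>h (\<tau> i) \<in> \<Theta>"
    and "i < n \<Longrightarrow> ereal (\<tau> (Suc i)) =
       min (ereal (\<tau> i + T))
         (trigger_time (loop_field f g k \<theta> (\<theta>h (\<tau> i))) (\<lambda>y. V (\<theta>h (\<tau> i), y)) a T (\<tau> i) (x (\<tau> i)))"
    and "i < n \<Longrightarrow> is_unique_arg_min (\<lambda>\<zeta>. (norm (\<zeta> - \<theta>h (\<tau> i)))\<^sup>2)
       (lsq_feasible \<Theta> f g x (\<lambda>t. k (\<theta>h t, x t)) (\<tau> (Suc i))) (\<theta>h (\<tau> (Suc i)))"
  using assms unfolding partial_sol_def by blast+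

lemma trajectory_less: "trajectory n x \<theta>h \<tau> \<Longrightarrow> i < j \<Longrightarrow> j \<le> n \<Longrightarrow> \<tau> i < \<tau> j"
proof (induction j)
  case (Suc j)
  have "\<tau> j < \<tau> (Suc j)" by (rule trajectoryD(2)[OF Suc.prems(1) Suc_le_lessD[OF Suc.prems(3)]])
  moreover have "\<tau> i < \<tau> j" if "i \<noteq> j" by (rule Suc.IH) (use Suc.prems that in simp_all)
  ultimately show ?case by (cases "i = j") simp_all
qed simp

lemma trajectory_le: "trajectory n x \<theta>h \<tau> \<Longrightarrow> i \<le> j \<Longrightarrow> j \<le> n \<Longrightarrow> \<tau> i \<le> \<tau> j"
  using trajectory_less[of n x \<theta>h \<tau> i j] by (cases "i = j") simp_all

lemma trajectory_nonneg: "trajectory n x \<theta>h \<tau> \<Longrightarrow> i \<le> n \<Longrightarrow> 0 \<le> \<tau> i"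
  using trajectory_le[of n x \<theta>h \<tau> 0 i] trajectoryD(1)[of n x \<theta>h \<tau>] by simp

lemma trajectory_restrict:
  assumes "trajectory n x \<theta>h \<tau>" "m \<le> n"
  shows "trajectory m x \<theta>h \<tau>"
proof -
  have "continuous_on {0..\<tau> m} x"
    by (rule continuous_on_subset[OF trajectoryD(3)[OF assms(1)]])
      (use trajectory_le[OF assms order_refl] in simp)
  moreover have "i < n" if "i < m" for i using that assms(2) by simp
  ultimately show ?thesis using assms(1) unfolding trajectory_def by blast
qed

lemma partial_sol_restrict: "partial_sol n x \<theta>h \<tau> \<Longrightarrow> m \<le> n \<Longrightarrow> partial_sol m x \<theta>h \<tau>"
  unfolding partial_sol_def using trajectory_restrict[of n x \<theta>h \<tau> m]
  by (meson order_less_le_trans order_trans)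

text \<open>Reduces the hybrid system to induction over steps. For continuity from right to left:
  near a point of \<open>{\<tau> i..<\<tau> (Suc i)}\<close> the whole domain lies in
  \<open>{0..\<tau> (Suc i)}\<close>, on which \<open>x\<close> is known to be continuous.\<close>

lemma hybrid_solution_iff:
  "hybrid_solution \<Theta> f g k V a T \<theta> x \<theta>h \<tau> \<longleftrightarrow> (\<forall>n. partial_sol n x \<theta>h \<tau>)"
proof
  assume h: "hybrid_solution \<Theta> f g k V a T \<theta> x \<theta>h \<tau>"
  show "\<forall>n. partial_sol n x \<theta>h \<tau>"
  proof
    fix n
    have sm: "strict_mono \<tau>" and t0: "\<tau> 0 = 0" and c: "continuous_on (\<Union>i. {\<tau> i..<\<tau> (Suc i)}) x"
      and in\<Theta>: "\<forall>i. \<theta>h (\<tau> i) \<in> \<Theta>"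
      and const: "\<forall>i. \<forall>t\<in>{\<tau> i..<\<tau> (Suc i)}. \<theta>h t = \<theta>h (\<tau> i)"
      and ode: "\<forall>i. ode_solution (loop_field f g k \<theta> (\<theta>h (\<tau> i))) {\<tau> i..<\<tau> (Suc i)} x"
      and trig: "\<forall>i. ereal (\<tau> (Suc i)) =
           min (ereal (\<tau> i + T))
               (trigger_time (loop_field f g k \<theta> (\<theta>h (\<tau> i))) (\<lambda>y. V (\<theta>h (\<tau> i), y)) a T
                  (\<tau> i) (x (\<tau> i)))"
      and lsq: "\<forall>i. is_unique_arg_min (\<lambda>\<zeta>. (norm (\<zeta> - \<theta>h (\<tau> i)))\<^sup>2)
           (lsq_feasible \<Theta> f g x (\<lambda>t. k (\<theta>h t, x t)) (\<tau> (Suc i))) (\<theta>h (\<tau> (Suc i)))"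
      using h unfolding hybrid_solution_def by - (elim conjE, assumption)+
    have "{0..\<tau> n} \<subseteq> (\<Union>i. {\<tau> i..<\<tau> (Suc i)})"
    proof
      fix t assume "t \<in> {0..\<tau> n}"
      then have "\<tau> 0 \<le> t" "t < \<tau> (Suc n)" using t0 strict_monoD[OF sm, of n "Suc n"] by auto
      then show "t \<in> (\<Union>i. {\<tau> i..<\<tau> (Suc i)})" by (rule strict_mono_cover) auto
    qed
    then have "continuous_on {0..\<tau> n} x" using c continuous_on_subset by blast
    then show "partial_sol n x \<theta>h \<tau>"
      unfolding partial_sol_def trajectory_def
      by (intro conjI allI impI ballI)
        (assumption | rule t0 strict_monoD[OF sm lessI] in\<Theta>[rule_format] const[rule_format]
          ode[rule_format] trig[rule_format] lsq[rule_format])+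
  qed
next
  assume p: "\<forall>n. partial_sol n x \<theta>h \<tau>"
  then have tr: "trajectory n x \<theta>h \<tau>" for n by (blast dest: partial_solD(1))
  have less: "\<tau> i < \<tau> j" if "i < j" for i j by (rule trajectory_less[OF tr that order_refl])
  have "continuous_on (\<Union>i. {\<tau> i..<\<tau> (Suc i)}) x"
    unfolding continuous_on_iff
  proof (intro ballI allI impI)
    fix t e :: real assume "t \<in> (\<Union>i. {\<tau> i..<\<tau> (Suc i)})" and e: "e > 0"
    then obtain i where i: "\<tau> i \<le> t" "t < \<tau> (Suc i)" by auto
    have nn: "0 \<le> \<tau> j" for j by (rule trajectory_nonneg[OF tr order_refl])
    have "continuous_on {0..\<tau> (Suc i)} x" by (rule trajectoryD(3)[OF tr])
    moreover have "t \<in> {0..\<tau> (Suc i)}" using i nn[of i] by auto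
    ultimately obtain d where d: "d > 0"
      "\<forall>s\<in>{0..\<tau> (Suc i)}. dist s t < d \<longrightarrow> dist (x s) (x t) < e"
      using e unfolding continuous_on_iff by blast
    show "\<exists>d>0. \<forall>s\<in>\<Union>i. {\<tau> i..<\<tau> (Suc i)}. dist s t < d \<longrightarrow> dist (x s) (x t) < e"
    proof (intro exI[of _ "min d (\<tau> (Suc i) - t)"] conjI ballI impI)
      fix s assume "s \<in> (\<Union>i. {\<tau> i..<\<tau> (Suc i)})" and st: "dist s t < min d (\<tau> (Suc i) - t)"
      then obtain j where "\<tau> j \<le> s" by auto
      then have "0 \<le> s" using nn[of j] by linarith
      moreover have "s \<le> \<tau> (Suc i)" using st by (simp add: dist_real_def) linarith
      ultimately show "dist (x s) (x t) < e" using d(2) st by simp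
    qed (use d i in auto)
  qed
  moreover have "\<tau> 0 = 0" by (rule trajectoryD(1)[OF tr])
  moreover have "strict_mono \<tau>" using less by (simp add: strict_mono_def)
  ultimately show "hybrid_solution \<Theta> f g k V a T \<theta> x \<theta>h \<tau>"
    unfolding hybrid_solution_def
    by (intro conjI allI ballI)
      (assumption | rule partial_solD(2)[OF p[rule_format] order_refl]
        trajectoryD(5,6)[OF tr lessI] partial_solD(3,4)[OF p[rule_format] lessI])+
qed

section \<open>Integrals along a trajectory and the feasible set\<close>

lemma continuous_on_feedback:
  assumes x: "continuous_on S x" and \<eta>: "\<eta> \<in> \<Theta>" and h: "continuous_on UNIV h"
  shows "continuous_on S (\<lambda>r. h (x r, k (\<eta>, x r)))"
proof -
  have "continuous_on S (\<lambda>r. k (\<eta>, x r))"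
    by (rule continuous_on_compose2[OF k]) (use x \<eta> in \<open>auto intro!: continuous_intros\<close>)
  then show ?thesis
    by (intro continuous_on_compose2[OF h]) (auto intro!: continuous_intros x)
qed

lemma trajectory_piece_continuous:
  assumes tr: "trajectory n x \<theta>h \<tau>" and i: "i < n"
  shows "continuous_on {\<tau> i..\<tau> (Suc i)} x"
  by (rule continuous_on_subset[OF trajectoryD(3)[OF tr]])
    (use i trajectory_nonneg[OF tr, of i] trajectory_le[OF tr, of "Suc i" n] in auto)

lemma trajectory_integrable:
  fixes h :: "(real^'n) \<times> (real^'m) \<Rightarrow> 'b::euclidean_space"
  assumes tr: "trajectory n x \<theta>h \<tau>" and h: "continuous_on UNIV h"
  shows "set_integrable lborel {0..\<tau> n} (\<lambda>r. h (x r, k (\<theta>h r, x r)))"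
proof -
  have "set_integrable lborel {\<tau> 0..\<tau> n} (\<lambda>r. h (x r, k (\<theta>h r, x r)))"
  proof (rule set_integrable_glue[THEN conjunct2])
    fix i assume i: "i < n"
    show "\<tau> i < \<tau> (Suc i)" by (rule trajectoryD(2)[OF tr i])
    have \<eta>: "\<theta>h (\<tau> i) \<in> \<Theta>" by (rule trajectoryD(4)[OF tr i])
    show "\<exists>h'. continuous_on {\<tau> i..\<tau> (Suc i)} h' \<and>
        (\<forall>r\<in>{\<tau> i..<\<tau> (Suc i)}. h (x r, k (\<theta>h r, x r)) = h' r)"
    proof (intro exI conjI ballI)
      show "continuous_on {\<tau> i..\<tau> (Suc i)} (\<lambda>r. h (x r, k (\<theta>h (\<tau> i), x r)))"
        by (rule continuous_on_feedback[OF trajectory_piece_continuous[OF tr i] \<eta> h])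
      show "h (x r, k (\<theta>h r, x r)) = h (x r, k (\<theta>h (\<tau> i), x r))" if "r \<in> {\<tau> i..<\<tau> (Suc i)}" for r
        unfolding trajectoryD(5)[OF tr i that] ..
    qed
  qed
  then show ?thesis by (simp add: trajectoryD(1)[OF tr])
qed

text \<open>The plant equation holds off the finitely many event times, an exceptional set that the
  fundamental theorem of calculus tolerates. This identity is what makes \<open>lsq_p\<close> equal
  to \<open>lsq_q\<close> applied to \<open>\<theta>\<close>.\<close>

lemma trajectory_integral_equation:
  assumes tr: "trajectory n x \<theta>h \<tau>" and t: "t \<in> {0..\<tau> n}"
  shows "x t - x 0 = integral {0..t} (\<lambda>r. f (x r, k (\<theta>h r, x r))) +
    integral {0..t} (\<lambda>r. g (x r, k (\<theta>h r, x r))) *v \<theta>"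
proof -
  let ?f = "\<lambda>r. f (x r, k (\<theta>h r, x r))" and ?g = "\<lambda>r. g (x r, k (\<theta>h r, x r))"
  have "((\<lambda>r. ?f r + ?g r *v \<theta>) has_integral (x t - x 0)) {0..t}"
  proof (rule fundamental_theorem_of_calculus_interior_strong[of "\<tau> ` {..n}"])
    show "continuous_on {0..t} x"
      by (rule continuous_on_subset[OF trajectoryD(3)[OF tr]]) (use t in auto)
    fix r assume r: "r \<in> {0<..<t} - \<tau> ` {..n}"
    then have "\<tau> 0 \<le> r" "r < \<tau> n" using t trajectoryD(1)[OF tr] by auto
    then obtain i where i: "i < n" "\<tau> i \<le> r" "r < \<tau> (Suc i)" by (rule strict_mono_cover)
    have "\<tau> i \<noteq> r" using r i by auto
    then have "(x has_vector_derivative loop_field f g k \<theta> (\<theta>h (\<tau> i)) (x r)) (at r)"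
      by (intro ode_solution_interior[of _ "\<tau> i" "\<tau> (Suc i)"])
        (use trajectoryD(6)[OF tr i(1)] i in auto)
    moreover have "\<theta>h r = \<theta>h (\<tau> i)" by (rule trajectoryD(5)[OF tr i(1)]) (use i in auto)
    ultimately show "(x has_vector_derivative ?f r + ?g r *v \<theta>) (at r)"
      by (simp add: loop_field_def)
  qed (use t in auto)
  moreover have int: "set_integrable lborel {0..t} h"
    if "set_integrable lborel {0..\<tau> n} h" for h :: "real \<Rightarrow> 'b::euclidean_space"
    by (rule set_integrable_subset[OF that]) (use t in auto)
  have "(?f has_integral integral {0..t} ?f) {0..t}"
    by (intro integrable_integral set_borel_integral_eq_integral(1) int trajectory_integrable[OF tr f])
  moreover have "(?g has_integral integral {0..t} ?g) {0..t}"
    by (intro integrable_integral set_borel_integral_eq_integral(1) int trajectory_integrable[OF tr g])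
  then have "((\<lambda>r. ?g r *v \<theta>) has_integral integral {0..t} ?g *v \<theta>) {0..t}"
    using has_integral_linear[OF _ bounded_linear_matrix_vector_mult_left, of ?g _ _ \<theta>]
    by (simp add: o_def)
  ultimately show ?thesis using has_integral_unique has_integral_add by blast
qed

text \<open>The normal equations say that the primitive \<open>Q\<close> of the regressor is
  constant in the direction \<open>\<zeta> - \<theta>\<close>. Differentiating \<open>Q\<close> from
  the right turns this into a pointwise condition on \<open>g\<close>; integration gives the
  converse.\<close>

lemma feasible_iff:
  assumes tr: "trajectory n x \<theta>h \<tau>" and n: "n > 0"
  shows "lsq_feasible \<Theta> f g x (\<lambda>t. k (\<theta>h t, x t)) (\<tau> n) =
    {\<zeta>\<in>\<Theta>. \<zeta> - \<theta> \<in> unexcited x \<theta>h (\<tau> n)}"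
proof -
  let ?u = "\<lambda>t. k (\<theta>h t, x t)"
  let ?f = "\<lambda>r. f (x r, ?u r)" and ?g = "\<lambda>r. g (x r, ?u r)"
  define Q where "Q t = integral {0..t} ?g" for t
  have b: "\<tau> n > 0" using trajectory_less[OF tr, of 0 n] trajectoryD(1)[OF tr] n by simp
  have ig: "set_integrable lborel {0..\<tau> n} ?g" by (rule trajectory_integrable[OF tr g])
  have intg: "?g integrable_on {0..\<tau> n}" by (rule set_borel_integral_eq_integral(1)[OF ig])
  have cQ: "continuous_on {0..\<tau> n} Q"
    unfolding Q_def by (rule indefinite_integral_continuous_1[OF intg])
  have q: "lsq_q g x ?u t s = Q t - Q s" if "t \<in> {0..\<tau> n}" "s \<in> {0..\<tau> n}" for t s
    unfolding lsq_q_def Q_def by (rule interval_integral_diff[OF ig that(2,1)])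
  have p: "lsq_p f x ?u t s = lsq_q g x ?u t s *v \<theta>" if ts: "t \<in> {0..\<tau> n}" "s \<in> {0..\<tau> n}" for t s
  proof -
    have "(LBINT r=ereal s..ereal t. ?f r) = integral {0..t} ?f - integral {0..s} ?f"
      by (rule interval_integral_diff[OF trajectory_integrable[OF tr f] ts(2,1)])
    moreover have "x t - x s = (x t - x 0) - (x s - x 0)" by simp
    ultimately show ?thesis
      unfolding lsq_p_def q[OF ts] trajectory_integral_equation[OF tr ts(1)]
        trajectory_integral_equation[OF tr ts(2)]
      by (simp add: Q_def matrix_vector_mult_diff_rdistrib)
  qed
  have "(\<forall>t\<in>{0..\<tau> n}. \<forall>s\<in>{0..\<tau> n}. (Q t - Q s) *v v = 0) \<longleftrightarrow> v \<in> unexcited x \<theta>h (\<tau> n)" for v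
  proof
    assume v: "v \<in> unexcited x \<theta>h (\<tau> n)"
    have "Q t *v v = 0" if t: "t \<in> {0..\<tau> n}" for t
    proof -
      have "?g integrable_on {0..t}" by (rule integrable_on_subinterval[OF intg]) (use t in auto)
      then have "((\<lambda>r. ?g r *v v) has_integral Q t *v v) {0..t}"
        unfolding Q_def
        using has_integral_linear[OF integrable_integral bounded_linear_matrix_vector_mult_left, of ?g _ v]
        by (simp add: o_def)
      \<comment> \<open>The point \<open>\<tau> n\<close> is split off because
        \<open>unexcited\<close> says nothing about the right end of the time interval.\<close>
      moreover have "((\<lambda>r. ?g r *v v) has_integral 0) {0..t}"
        by (rule has_integral_spike_finite[of "{\<tau> n}" _ _ "\<lambda>r. 0"])
          (use v t in \<open>auto simp: unexcited_def\<close>)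
      ultimately show ?thesis by (rule has_integral_unique)
    qed
    then show "\<forall>t\<in>{0..\<tau> n}. \<forall>s\<in>{0..\<tau> n}. (Q t - Q s) *v v = 0"
      by (simp add: matrix_vector_mult_diff_rdistrib)
  next
    assume z: "\<forall>t\<in>{0..\<tau> n}. \<forall>s\<in>{0..\<tau> n}. (Q t - Q s) *v v = 0"
    have "?g r *v v = 0" if r: "r \<in> {0..<\<tau> n}" for r
    proof -
      obtain i where i: "i < n" "\<tau> i \<le> r" "r < \<tau> (Suc i)"
        using strict_mono_cover[of \<tau> r n] r trajectoryD(1)[OF tr] by auto
      \<comment> \<open>With the estimate frozen at \<open>\<eta>\<close> the integrand
        \<open>?h\<close> is continuous up to \<open>\<tau> (Suc i)\<close>, the only point of the
        closed interval where it may differ from the actual one.\<close>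
      define \<eta> where "\<eta> = \<theta>h (\<tau> i)"
      let ?h = "\<lambda>s. g (x s, k (\<eta>, x s)) *v v"
      have si: "\<tau> (Suc i) \<le> \<tau> n" by (rule trajectory_le[OF tr]) (use i in auto)
      have \<eta>: "\<eta> \<in> \<Theta>" and \<eta>r: "\<And>s. s \<in> {\<tau> i..<\<tau> (Suc i)} \<Longrightarrow> \<theta>h s = \<eta>"
        unfolding \<eta>_def using trajectoryD(4,5)[OF tr i(1)] by blast+
      have ch: "continuous_on {r..\<tau> (Suc i)} ?h"
        by (rule continuous_on_subset[of "{\<tau> i..\<tau> (Suc i)}"])
          (use i in \<open>auto intro!: continuous_on_matrix_vector_mult continuous_intros
              continuous_on_feedback[OF trajectory_piece_continuous[OF tr] \<eta> g]\<close>)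
      have zero: "integral {r..s} ?h = 0" if s: "s \<in> {r..\<tau> (Suc i)}" for s
      proof -
        have "?g integrable_on {r..s}" by (rule integrable_on_subinterval[OF intg]) (use r s si in auto)
        then have "((\<lambda>r. ?g r *v v) has_integral integral {r..s} ?g *v v) {r..s}"
          using has_integral_linear[OF integrable_integral bounded_linear_matrix_vector_mult_left, of ?g _ v]
          by (simp add: o_def)
        then have "(?h has_integral integral {r..s} ?g *v v) {r..s}"
          by (rule has_integral_spike_finite[of "{\<tau> (Suc i)}", rotated 2])
            (use i s in \<open>auto simp: \<eta>r\<close>)
        moreover have "?g integrable_on {0..s}"
          by (rule integrable_on_subinterval[OF intg]) (use r s si in auto)
        then have "Q r + integral {r..s} ?g = Q s"
          unfolding Q_def by (rule Henstock_Kurzweil_Integration.integral_combine[rotated 2]) (use r s in auto)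
        then have "integral {r..s} ?g = Q s - Q r" by (simp add: algebra_simps)
        then have "integral {r..s} ?g *v v = (Q s - Q r) *v v" by (rule arg_cong)
        moreover have "(Q s - Q r) *v v = 0" using z r s si by auto
        ultimately show ?thesis by (simp add: integral_unique)
      qed
      \<comment> \<open>The primitive of \<open>?h\<close> from \<open>r\<close> vanishes
        identically, while its right derivative at \<open>r\<close> is \<open>?h r\<close>. Being
        one-sided, the argument includes the case that \<open>r\<close> is an event time.\<close>
      have "((\<lambda>s. integral {r..s} ?h) has_vector_derivative ?h r) (at r within {r..\<tau> (Suc i)})"
        by (rule integral_has_vector_derivative[OF ch]) (use i in auto)
      moreover have "((\<lambda>s. integral {r..s} ?h) has_vector_derivative 0) (at r within {r..\<tau> (Suc i)})"
        by (rule has_vector_derivative_transform[OF _ zero has_vector_derivative_const]) (use i in auto)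
      ultimately have "?h r = 0"
        by (rule vector_derivative_unique_within_closed_interval[of r "\<tau> (Suc i)" r, rotated 2, unfolded cbox_interval])
          (use i in auto)
      then show ?thesis using \<eta>r[of r] i by simp
    qed
    then show "v \<in> unexcited x \<theta>h (\<tau> n)" by (simp add: unexcited_def)
  qed
  note excitation = this
  have "(LBINT t=ereal 0..ereal (\<tau> n). (LBINT s=ereal 0..ereal (\<tau> n).
        transpose (lsq_q g x ?u t s) *v lsq_p f x ?u t s)) =
      (LBINT t=ereal 0..ereal (\<tau> n). (LBINT s=ereal 0..ereal (\<tau> n).
        transpose (lsq_q g x ?u t s) ** lsq_q g x ?u t s)) *v \<zeta> \<longleftrightarrow>
      (\<forall>t\<in>{0..\<tau> n}. \<forall>s\<in>{0..\<tau> n}. (Q t - Q s) *v (\<zeta> - \<theta>) = 0)" for \<zeta>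
    by (rule normal_equation_iff[OF b cQ]) (rule q p; assumption)+
  then show ?thesis unfolding lsq_feasible_def by (simp only: excitation)
qed

text \<open>The next event time depends only on the state and the estimate at
  \<open>\<tau> n\<close>; the state up to and including that time is determined by uniqueness for
  the differential equation; the feasible set depends only on the open past, so the new estimate, a
  unique minimizer, is determined as well.\<close>

lemma partial_sol_unique:
  assumes "partial_sol n x \<theta>h \<tau>" "partial_sol n x' \<theta>h' \<tau>'" "x 0 = x' 0" "\<theta>h 0 = \<theta>h' 0"
  shows "(\<forall>i\<le>n. \<tau> i = \<tau>' i) \<and> (\<forall>t\<in>{0..\<tau> n}. x t = x' t \<and> \<theta>h t = \<theta>h' t)"
  using assms
proof (induction n)
  case 0
  have "\<tau> 0 = 0" "\<tau>' 0 = 0"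
    using trajectoryD(1)[OF partial_solD(1)] 0 by blast+
  then show ?case using 0 by simp
next
  case (Suc n)
  note p = Suc.prems(1) and p' = Suc.prems(2)
  note tr = partial_solD(1)[OF p] and tr' = partial_solD(1)[OF p']
  have IH: "\<forall>i\<le>n. \<tau> i = \<tau>' i" "\<forall>t\<in>{0..\<tau> n}. x t = x' t \<and> \<theta>h t = \<theta>h' t"
    using Suc.IH[OF partial_sol_restrict[OF p] partial_sol_restrict[OF p'] Suc.prems(3,4)] by auto
  define s where "s = \<tau> n"
  define \<eta> where "\<eta> = \<theta>h s"
  define b where "b = \<tau> (Suc n)"
  have s': "\<tau>' n = s" using IH(1) by (simp add: s_def)
  have s0: "0 \<le> s" unfolding s_def by (rule trajectory_nonneg[OF tr]) simp
  have xs: "x' s = x s" and \<eta>': "\<theta>h' s = \<eta>" using IH(2) s0 by (simp_all add: s_def \<eta>_def)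
  have "ereal b = ereal (\<tau>' (Suc n))"
    using partial_solD(3)[OF p lessI] partial_solD(3)[OF p' lessI]
    unfolding b_def s' xs \<eta>' s_def[symmetric] \<eta>_def[symmetric] by (rule trans[OF _ sym])
  then have b': "\<tau>' (Suc n) = b" by simp
  have sb: "s < b" using trajectoryD(2)[OF tr lessI] by (simp add: s_def b_def)
  have \<eta>: "\<eta> \<in> \<Theta>" using trajectoryD(4)[OF tr lessI] by (simp add: s_def \<eta>_def)
  have xeq2: "x t = x' t" if "t \<in> {s..b}" for t
    by (rule ode_solution_unique[OF lip[OF \<eta>] _ _ _ _ _ that])
      (use trajectoryD(6)[OF tr lessI] trajectoryD(6)[OF tr' lessI] xs
        trajectory_piece_continuous[OF tr lessI] trajectory_piece_continuous[OF tr' lessI] in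
        \<open>simp_all only: s_def[symmetric] s' b_def[symmetric] b' \<eta>_def[symmetric] \<eta>'\<close>)
  have xeq: "x t = x' t" if "t \<in> {0..b}" for t
    using IH(2) xeq2[of t] that by (cases "t \<le> s") (auto simp: s_def)
  have \<theta>eq: "\<theta>h t = \<theta>h' t" if "t \<in> {0..<b}" for t
  proof (cases "t < s")
    case True
    then show ?thesis using IH(2) that by (simp add: s_def)
  next
    case False
    then have t: "t \<in> {s..<b}" using that by simp
    have "\<theta>h t = \<eta>"
      using trajectoryD(5)[OF tr lessI, of t] t by (simp only: s_def[symmetric] b_def[symmetric] \<eta>_def[symmetric])
    moreover have "\<theta>h' t = \<eta>"
      using trajectoryD(5)[OF tr' lessI, of t] t by (simp only: s' b' \<eta>')
    ultimately show ?thesis by simp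
  qed
  have "lsq_feasible \<Theta> f g x (\<lambda>t. k (\<theta>h t, x t)) b = lsq_feasible \<Theta> f g x' (\<lambda>t. k (\<theta>h' t, x' t)) b"
    by (rule lsq_feasible_cong) (use s0 sb xeq \<theta>eq in simp_all)
  then have "\<theta>h b = \<theta>h' b"
    using partial_solD(4)[OF p lessI] partial_solD(4)[OF p' lessI]
    unfolding s' b' \<eta>' s_def[symmetric] b_def[symmetric] \<eta>_def[symmetric]
    by (simp only:) (rule is_unique_arg_min_unique)
  then have "\<theta>h t = \<theta>h' t" if "t \<in> {0..b}" for t
    using \<theta>eq[of t] that by (cases "t = b") simp_all
  then show ?case using xeq IH(1) b' by (auto simp: le_Suc_eq b_def)
qed

section \<open>Parameter updates as projections, and decay without an update\<close>

lemma feasible_eq_translation: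
  "{\<zeta>\<in>\<Theta>. \<zeta> - \<theta> \<in> unexcited x \<theta>h b} = \<Theta> \<inter> (+) \<theta> ` unexcited x \<theta>h b"
proof -
  have "\<zeta> \<in> (+) \<theta> ` unexcited x \<theta>h b" if "\<zeta> - \<theta> \<in> unexcited x \<theta>h b" for \<zeta>
    by (rule image_eqI[OF _ that]) simp
  moreover have "\<zeta> - \<theta> \<in> unexcited x \<theta>h b" if "\<zeta> \<in> (+) \<theta> ` unexcited x \<theta>h b" for \<zeta>
    using that by (rule imageE) simp
  ultimately show ?thesis by blast
qed

lemma
  shows convex_feasible: "convex {\<zeta>\<in>\<Theta>. \<zeta> - \<theta> \<in> unexcited x \<theta>h b}"
    and closed_feasible: "closed {\<zeta>\<in>\<Theta>. \<zeta> - \<theta> \<in> unexcited x \<theta>h b}"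
    and true_parameter_feasible: "\<theta> \<in> {\<zeta>\<in>\<Theta>. \<zeta> - \<theta> \<in> unexcited x \<theta>h b}"
proof -
  show "convex {\<zeta>\<in>\<Theta>. \<zeta> - \<theta> \<in> unexcited x \<theta>h b}"
    unfolding feasible_eq_translation
    by (intro convex_Int convex_\<Theta> convex_translation subspace_imp_convex subspace_unexcited)
  show "closed {\<zeta>\<in>\<Theta>. \<zeta> - \<theta> \<in> unexcited x \<theta>h b}"
    unfolding feasible_eq_translation
    by (intro closed_Int closed_\<Theta> closed_translation closed_subspace subspace_unexcited)
  show "\<theta> \<in> {\<zeta>\<in>\<Theta>. \<zeta> - \<theta> \<in> unexcited x \<theta>h b}"
    using \<theta> subspace_0[OF subspace_unexcited] by simp
qed

text \<open>By \<open>feasible_iff\<close> the new estimate is the projection of the old one onto a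
  closed convex set that contains \<open>\<theta>\<close>; an old estimate that is still feasible is
  its own projection.\<close>

lemma
  assumes p: "partial_sol n x \<theta>h \<tau>" and i: "i < n"
  shows update_feasible: "\<theta>h (\<tau> (Suc i)) - \<theta> \<in> unexcited x \<theta>h (\<tau> (Suc i))"
    and update_contracts: "norm (\<theta>h (\<tau> (Suc i)) - \<theta>) \<le> norm (\<theta>h (\<tau> i) - \<theta>)"
    and update_trivial: "\<theta>h (\<tau> i) - \<theta> \<in> unexcited x \<theta>h (\<tau> (Suc i)) \<Longrightarrow> \<theta>h (\<tau> (Suc i)) = \<theta>h (\<tau> i)"
proof -
  let ?S = "{\<zeta>\<in>\<Theta>. \<zeta> - \<theta> \<in> unexcited x \<theta>h (\<tau> (Suc i))}"
  have "trajectory (Suc i) x \<theta>h \<tau>"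
    by (rule trajectory_restrict[OF partial_solD(1)[OF p]]) (use i in simp)
  note feasible = feasible_iff[OF this zero_less_Suc]
  have m: "is_unique_arg_min (\<lambda>\<zeta>. (norm (\<zeta> - \<theta>h (\<tau> i)))\<^sup>2) ?S (\<theta>h (\<tau> (Suc i)))"
    unfolding feasible[symmetric] by (rule partial_solD(4)[OF p i])
  show "\<theta>h (\<tau> (Suc i)) - \<theta> \<in> unexcited x \<theta>h (\<tau> (Suc i))"
    using is_unique_arg_minD(1)[OF m] by blast
  show "norm (\<theta>h (\<tau> (Suc i)) - \<theta>) \<le> norm (\<theta>h (\<tau> i) - \<theta>)"
    by (rule projection_contracts[OF convex_feasible closed_feasible true_parameter_feasible m])
  assume "\<theta>h (\<tau> i) - \<theta> \<in> unexcited x \<theta>h (\<tau> (Suc i))"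
  moreover have "\<theta>h (\<tau> i) \<in> \<Theta>" by (rule partial_solD(2)[OF p]) (use i in simp)
  ultimately have "\<theta>h (\<tau> i) \<in> ?S" by blast
  from is_unique_arg_minD(2)[OF m this] show "\<theta>h (\<tau> (Suc i)) = \<theta>h (\<tau> i)" by simp
qed

lemma dim_unexcited_le: "dim (unexcited x \<theta>h b) \<le> CARD('l)"
  using dim_subset_UNIV[of "unexcited x \<theta>h b"] by simp

lemma dim_unexcited_antimono: "b \<le> c \<Longrightarrow> dim (unexcited x \<theta>h c) \<le> dim (unexcited x \<theta>h b)"
  by (rule dim_subset[OF unexcited_antimono])

text \<open>A parameter update makes a new direction excited, so that there are at most \<open>CARD('l)\<close> of
  them.\<close>

lemma dim_unexcited_less:
  assumes p: "partial_sol n x \<theta>h \<tau>" and i: "i < n" and ne: "\<theta>h (\<tau> (Suc i)) \<noteq> \<theta>h (\<tau> i)"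
  shows "dim (unexcited x \<theta>h (\<tau> (Suc i))) < dim (unexcited x \<theta>h (\<tau> i))"
proof -
  \<comment> \<open>The old parameter error is the vector that leaves the space: it lies in the old
    one, by feasibility of the preceding update or, at time 0, because nothing has been observed
    yet, but not in the new one.\<close>
  have "\<theta>h (\<tau> i) - \<theta> \<in> unexcited x \<theta>h (\<tau> i)"
  proof (cases i)
    case 0
    then show ?thesis using trajectoryD(1)[OF partial_solD(1)[OF p]] by (simp add: unexcited_def)
  next
    case (Suc j)
    then show ?thesis using update_feasible[OF p, of j] i by simp
  qed
  moreover have "\<theta>h (\<tau> i) - \<theta> \<notin> unexcited x \<theta>h (\<tau> (Suc i))"
    using update_trivial[OF p i] ne by blast
  moreover have "\<tau> i \<le> \<tau> (Suc i)"
    using trajectoryD(2)[OF partial_solD(1)[OF p] i] by simp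
  ultimately have "unexcited x \<theta>h (\<tau> (Suc i)) \<subset> unexcited x \<theta>h (\<tau> i)"
    using unexcited_antimono[of "\<tau> i" "\<tau> (Suc i)" x \<theta>h] by blast
  then show ?thesis
    by (intro dim_psubset) (simp only: span_eq_iff[THEN iffD2, OF subspace_unexcited])
qed

text \<open>By \<open>indist\<close> the field along \<open>x\<close> is the same for the parameters
  \<open>\<theta>\<close> and \<open>\<eta>\<close>, so the decay inequality, which assumes matching
  parameters, may be used with \<open>\<eta>\<close>.\<close>

lemma lyapunov_decay:
  assumes \<eta>: "\<eta> \<in> \<Theta>" and diff: "\<And>y. (\<lambda>y. V (\<eta>, y)) differentiable (at y)"
    and H1: "\<And>y. frechet_derivative (\<lambda>y. V (\<eta>, y)) (at y) (f (y, k (\<eta>, y)) + g (y, k (\<eta>, y)) *v \<eta>)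
        \<le> - 2 * \<sigma> * V (\<eta>, y)"
    and x: "ode_solution (loop_field f g k \<theta> \<eta>) {s..<b} x" "continuous_on {s..b} x"
    and indist: "\<And>r. r \<in> {s..<b} \<Longrightarrow> g (x r, k (\<eta>, x r)) *v (\<eta> - \<theta>) = 0"
    and t: "t \<in> {s..b}"
  shows "exp (2 * \<sigma> * t) * V (\<eta>, x t) \<le> exp (2 * \<sigma> * s) * V (\<eta>, x s)"
proof -
  let ?\<phi> = "\<lambda>r. exp (2 * \<sigma> * r) * V (\<eta>, x r)"
  show ?thesis
  proof (rule DERIV_nonpos_imp_decreasing_open[of s t ?\<phi>])
    show "s \<le> t" using t by simp
    have "continuous_on {s..b} (\<lambda>r. V (\<eta>, x r))"
      by (rule continuous_on_compose2[OF V[OF \<eta>] x(2)]) simp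
    then have "continuous_on {s..b} ?\<phi>" by (intro continuous_intros)
    then show "continuous_on {s..t} ?\<phi>" by (rule continuous_on_subset) (use t in auto)
    fix r assume r: "s < r" "r < t"
    then have rb: "r < b" using t by simp
    let ?F = "f (x r, k (\<eta>, x r)) + g (x r, k (\<eta>, x r)) *v \<eta>"
    have "loop_field f g k \<theta> \<eta> (x r) = ?F"
      using indist[of r] r rb by (simp add: loop_field_def matrix_vector_mult_diff_distrib)
    then have dx: "(x has_vector_derivative ?F) (at r)"
      using ode_solution_interior[OF x(1) r(1) rb] by simp
    have "((\<lambda>y. V (\<eta>, y)) has_derivative frechet_derivative (\<lambda>y. V (\<eta>, y)) (at (x r))) (at (x r))"
      using diff frechet_derivative_works by blast
    from vector_derivative_diff_chain_within[OF dx has_derivative_at_withinI[OF this]]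
    have "((\<lambda>r. V (\<eta>, x r)) has_real_derivative frechet_derivative (\<lambda>y. V (\<eta>, y)) (at (x r)) ?F) (at r)"
      by (simp add: o_def has_real_derivative_iff_has_vector_derivative)
    note dV = this
    have dexp: "((\<lambda>r. exp (2 * \<sigma> * r)) has_real_derivative exp (2 * \<sigma> * r) * (2 * \<sigma>)) (at r)"
      by (auto intro!: derivative_eq_intros)
    have "(?\<phi> has_real_derivative exp (2 * \<sigma> * r) *
        (frechet_derivative (\<lambda>y. V (\<eta>, y)) (at (x r)) ?F + 2 * \<sigma> * V (\<eta>, x r))) (at r)"
      by (rule DERIV_cong[OF DERIV_mult[OF dexp dV]]) (simp add: distrib_left mult_ac)
    moreover have "exp (2 * \<sigma> * r) *
        (frechet_derivative (\<lambda>y. V (\<eta>, y)) (at (x r)) ?F + 2 * \<sigma> * V (\<eta>, x r)) \<le> 0"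
      using H1[of "x r"] by (intro mult_nonneg_nonpos) simp_all
    ultimately show "\<exists>D. (?\<phi> has_real_derivative D) (at r) \<and> D \<le> 0" by blast
  qed
qed

section \<open>Extending, modifying and gluing partial solutions\<close>

lemma trajectory_SucI:
  assumes tr: "trajectory n x \<theta>h \<tau>" and lt: "\<tau> n < \<tau> (Suc n)"
    and x: "continuous_on {\<tau> n..\<tau> (Suc n)} x" and \<eta>: "\<theta>h (\<tau> n) \<in> \<Theta>"
    and const: "\<And>t. t \<in> {\<tau> n..<\<tau> (Suc n)} \<Longrightarrow> \<theta>h t = \<theta>h (\<tau> n)"
    and ode: "ode_solution (loop_field f g k \<theta> (\<theta>h (\<tau> n))) {\<tau> n..<\<tau> (Suc n)} x"
  shows "trajectory (Suc n) x \<theta>h \<tau>"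
proof -
  have "{0..\<tau> n} \<union> {\<tau> n..\<tau> (Suc n)} = {0..\<tau> (Suc n)}"
    using lt trajectory_nonneg[OF tr order_refl] by auto
  moreover have "continuous_on ({0..\<tau> n} \<union> {\<tau> n..\<tau> (Suc n)}) x"
    by (intro continuous_on_closed_Un closed_atLeastAtMost x trajectoryD(3)[OF tr])
  ultimately have c: "continuous_on {0..\<tau> (Suc n)} x" by (simp only:)
  show ?thesis
    unfolding trajectory_def All_less_Suc
    by (intro conjI allI impI ballI c lt \<eta> ode const; (assumption | rule trajectoryD[OF tr]; assumption)?)
qed

lemma partial_sol_SucI:
  assumes p: "partial_sol n x \<theta>h \<tau>" and lt: "\<tau> n < \<tau> (Suc n)"
    and x: "continuous_on {\<tau> n..\<tau> (Suc n)} x"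
    and const: "\<And>t. t \<in> {\<tau> n..<\<tau> (Suc n)} \<Longrightarrow> \<theta>h t = \<theta>h (\<tau> n)"
    and ode: "ode_solution (loop_field f g k \<theta> (\<theta>h (\<tau> n))) {\<tau> n..<\<tau> (Suc n)} x"
    and \<eta>: "\<theta>h (\<tau> (Suc n)) \<in> \<Theta>"
    and trigger: "ereal (\<tau> (Suc n)) =
       min (ereal (\<tau> n + T))
         (trigger_time (loop_field f g k \<theta> (\<theta>h (\<tau> n))) (\<lambda>y. V (\<theta>h (\<tau> n), y)) a T (\<tau> n) (x (\<tau> n)))"
    and lsq: "is_unique_arg_min (\<lambda>\<zeta>. (norm (\<zeta> - \<theta>h (\<tau> n)))\<^sup>2)
       (lsq_feasible \<Theta> f g x (\<lambda>t. k (\<theta>h t, x t)) (\<tau> (Suc n))) (\<theta>h (\<tau> (Suc n)))"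
  shows "partial_sol (Suc n) x \<theta>h \<tau>"
proof -
  have tr: "trajectory (Suc n) x \<theta>h \<tau>"
    by (rule trajectory_SucI[OF partial_solD(1)[OF p] lt x partial_solD(2)[OF p order_refl] const ode])
  have \<Theta>: "\<theta>h (\<tau> i) \<in> \<Theta>" if "i \<le> Suc n" for i
    using partial_solD(2)[OF p, of i] \<eta> that by (cases "i = Suc n") simp_all
  show ?thesis
    unfolding partial_sol_def All_less_Suc
    by (intro conjI allI impI tr trigger lsq \<Theta>)
      (assumption | rule partial_solD(3)[OF p] partial_solD(4)[OF p])+
qed

text \<open>Permits redefining the functions beyond \<open>\<tau> n\<close>, both when a step is
  appended and when partial solutions are glued. The least-squares condition is the one that needs
  care, as it involves the whole past through integrals.\<close>

lemma partial_sol_cong: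
  assumes p: "partial_sol n x \<theta>h \<tau>" and \<tau>': "\<And>i. i \<le> n \<Longrightarrow> \<tau>' i = \<tau> i"
    and eq: "\<And>t. t \<in> {0..\<tau> n} \<Longrightarrow> x' t = x t" "\<And>t. t \<in> {0..\<tau> n} \<Longrightarrow> \<theta>h' t = \<theta>h t"
  shows "partial_sol n x' \<theta>h' \<tau>'"
  using assms
proof (induction n)
  case 0
  have t: "\<tau> 0 = 0" "\<tau>' 0 = 0" using trajectoryD(1)[OF partial_solD(1)[OF "0.prems"(1)]] "0.prems"(2) by simp_all
  have "\<theta>h' 0 \<in> \<Theta>" using partial_solD(2)[OF "0.prems"(1), of 0] "0.prems"(4) t by simp
  then show ?case unfolding partial_sol_def trajectory_def by (simp add: t)
next
  case (Suc n)
  note p = Suc.prems(1)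
  note tr = partial_solD(1)[OF p]
  define s where "s = \<tau> n"
  define b where "b = \<tau> (Suc n)"
  have \<tau>': "\<tau>' n = s" "\<tau>' (Suc n) = b" using Suc.prems(2) by (simp_all add: s_def b_def)
  have s0: "0 \<le> s" unfolding s_def by (rule trajectory_nonneg[OF tr]) simp
  have sb: "s < b" using trajectoryD(2)[OF tr lessI] by (simp add: s_def b_def)
  have xe: "\<And>t. t \<in> {0..b} \<Longrightarrow> x' t = x t" and \<theta>e: "\<And>t. t \<in> {0..b} \<Longrightarrow> \<theta>h' t = \<theta>h t"
    using Suc.prems(3,4) unfolding b_def by blast+
  have xs: "x' s = x s" and \<theta>s: "\<theta>h' s = \<theta>h s" and \<theta>b: "\<theta>h' b = \<theta>h b" using xe[of s] \<theta>e[of s] \<theta>e[of b] s0 sb by simp_all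
  have IH: "partial_sol n x' \<theta>h' \<tau>'"
    by (rule Suc.IH[OF partial_sol_restrict[OF p]])
      (use Suc.prems(2) xe \<theta>e sb in \<open>simp_all add: s_def b_def\<close>)
  show ?case
  proof (rule partial_sol_SucI[OF IH], unfold \<tau>' xs \<theta>s \<theta>b)
    show "s < b" by (rule sb)
    have "continuous_on {s..b} x" using trajectory_piece_continuous[OF tr lessI] unfolding s_def b_def .
    then show "continuous_on {s..b} x'"
      by (subst continuous_on_cong[OF refl]) (use xe s0 in simp_all)
    show "\<theta>h' t = \<theta>h s" if t: "t \<in> {s..<b}" for t
    proof -
      have "\<theta>h' t = \<theta>h t" by (rule \<theta>e) (use t s0 in simp)
      also have "\<dots> = \<theta>h s" using trajectoryD(5)[OF tr lessI] t unfolding s_def b_def by blast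
      finally show ?thesis .
    qed
    have "ode_solution (loop_field f g k \<theta> (\<theta>h s)) {s..<b} x"
      using trajectoryD(6)[OF tr lessI] unfolding s_def b_def .
    then show "ode_solution (loop_field f g k \<theta> (\<theta>h s)) {s..<b} x'"
      by (rule ode_solution_cong) (use xe s0 in simp)
    show "\<theta>h b \<in> \<Theta>" using partial_solD(2)[OF p order_refl] unfolding b_def .
    show "ereal b = min (ereal (s + T))
         (trigger_time (loop_field f g k \<theta> (\<theta>h s)) (\<lambda>y. V (\<theta>h s, y)) a T s (x s))"
      using partial_solD(3)[OF p lessI] unfolding s_def b_def .
    have "lsq_feasible \<Theta> f g x' (\<lambda>t. k (\<theta>h' t, x' t)) b = lsq_feasible \<Theta> f g x (\<lambda>t. k (\<theta>h t, x t)) b"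
      by (rule lsq_feasible_cong) (use s0 sb xe \<theta>e in simp_all)
    then show "is_unique_arg_min (\<lambda>\<zeta>. (norm (\<zeta> - \<theta>h s))\<^sup>2)
       (lsq_feasible \<Theta> f g x' (\<lambda>t. k (\<theta>h' t, x' t)) b) (\<theta>h b)"
      using partial_solD(4)[OF p lessI] unfolding s_def b_def by (simp only:)
  qed
qed

text \<open>The partial solutions for different \<open>n\<close> are chosen independently;
  uniqueness makes them agree on common domains, so a diagonal choice yields a single
  solution.\<close>

lemma hybrid_solution_glue:
  assumes ex: "\<And>n. \<exists>x \<theta>h \<tau>. partial_sol n x \<theta>h \<tau> \<and> x 0 = x0 \<and> \<theta>h 0 = \<theta>0"
  obtains x \<theta>h \<tau> where "\<And>n. partial_sol n x \<theta>h \<tau>" "x 0 = x0" "\<theta>h 0 = \<theta>0"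
proof -
  have "\<forall>n. \<exists>z. partial_sol n (fst z) (fst (snd z)) (snd (snd z)) \<and> fst z 0 = x0 \<and> fst (snd z) 0 = \<theta>0"
    using ex by simp
  then obtain Z where Z: "\<forall>n. partial_sol n (fst (Z n)) (fst (snd (Z n))) (snd (snd (Z n))) \<and>
      fst (Z n) 0 = x0 \<and> fst (snd (Z n)) 0 = \<theta>0"
    by (rule choice[THEN exE])
  define X H S where "X n = fst (Z n)" and "H n = fst (snd (Z n))" and "S n = snd (snd (Z n))" for n
  have p: "partial_sol n (X n) (H n) (S n)" and X0: "X n 0 = x0" and H0: "H n 0 = \<theta>0" for n
    using Z unfolding X_def H_def S_def by blast+
  have agree: "(\<forall>i\<le>m. S m i = S n i) \<and> (\<forall>t\<in>{0..S m m}. X m t = X n t \<and> H m t = H n t)"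
    if "m \<le> n" for m n
    by (rule partial_sol_unique[OF p partial_sol_restrict[OF p that]]) (simp_all add: X0 H0)
  define \<tau> where "\<tau> n = S n n" for n
  \<comment> \<open>Any index whose domain contains \<open>t\<close> would give the same values. For
    \<open>t\<close> beyond all event times \<open>N t\<close> is unspecified, and no partial
    solution looks there.\<close>
  define N where "N t = (LEAST n. t \<le> \<tau> n)" for t
  define x \<theta>h where "x t = X (N t) t" and "\<theta>h t = H (N t) t" for t
  have "partial_sol n x \<theta>h \<tau>" for n
  proof (rule partial_sol_cong[OF p])
    show "\<tau> i = S n i" if "i \<le> n" for i using agree[OF that] by (simp add: \<tau>_def)
    fix t assume t: "t \<in> {0..S n n}"
    have le: "t \<le> \<tau> n" using t by (simp add: \<tau>_def)
    have "N t \<le> n" unfolding N_def by (rule Least_le[of "\<lambda>n. t \<le> \<tau> n", OF le])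
    moreover have "t \<le> \<tau> (N t)" unfolding N_def by (rule LeastI[of "\<lambda>n. t \<le> \<tau> n", OF le])
    ultimately have "X (N t) t = X n t \<and> H (N t) t = H n t"
      using agree[of "N t" n] t by (simp add: \<tau>_def)
    then show "x t = X n t" "\<theta>h t = H n t" by (simp_all add: x_def \<theta>h_def)
  qed
  then show thesis by (rule that) (simp_all add: x_def \<theta>h_def X0 H0)
qed

lemma partial_sol_0: "\<eta> \<in> \<Theta> \<Longrightarrow> partial_sol 0 (\<lambda>_. \<xi>) (\<lambda>_. \<eta>) (\<lambda>_. 0)"
  by (simp add: partial_sol_def trajectory_def)

end

section \<open>Estimates near the equilibrium\<close>

text \<open>\<open>r0\<close> bounds the parameter error and \<open>\<rho>\<close> the state; within
  these limits \<open>K1\<close>, \<open>K2\<close> and \<open>A\<close> do not depend on the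
  estimate. All quantitative work is done under these local bounds.\<close>

locale local_bounds = adaptive_loop \<Theta> f g k V a T \<theta>
  for \<Theta> :: "(real^'l) set"
    and f :: "(real^'n) \<times> (real^'m) \<Rightarrow> real^'n"
    and g :: "(real^'n) \<times> (real^'m) \<Rightarrow> real^'l^'n"
    and k :: "(real^'l) \<times> (real^'n) \<Rightarrow> real^'m"
    and V :: "(real^'l) \<times> (real^'n) \<Rightarrow> real"
    and a :: "real^'n \<Rightarrow> real"
    and T :: real and \<theta> :: "real^'l" +
  fixes \<sigma> K1 K2 A \<rho> r0 :: real
  assumes \<sigma>: "\<sigma> > 0"
    and diff: "\<eta> \<in> \<Theta> \<Longrightarrow> (\<lambda>y. V (\<eta>, y)) differentiable (at y)"
    and H1: "\<eta> \<in> \<Theta> \<Longrightarrow>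
      frechet_derivative (\<lambda>y. V (\<eta>, y)) (at y) (f (y, k (\<eta>, y)) + g (y, k (\<eta>, y)) *v \<eta>)
        \<le> - 2 * \<sigma> * V (\<eta>, y)"
    and K1: "K1 > 0" and K2: "K2 > K1" and A: "A \<ge> 0" and \<rho>: "\<rho> > 0"
    and lower: "\<eta> \<in> \<Theta> \<Longrightarrow> norm (\<eta> - \<theta>) \<le> r0 \<Longrightarrow> norm y \<le> \<rho> \<Longrightarrow> K1 * (norm y)\<^sup>2 \<le> V (\<eta>, y)"
    and upper: "\<eta> \<in> \<Theta> \<Longrightarrow> norm (\<eta> - \<theta>) \<le> r0 \<Longrightarrow> norm y \<le> \<rho> \<Longrightarrow> V (\<eta>, y) \<le> K2 * (norm y)\<^sup>2"
    and threshold: "norm y \<le> \<rho> \<Longrightarrow> a y \<le> A * (norm y)\<^sup>2"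
begin

text \<open>Over an inter-event interval that ends with a parameter update, \<open>exp (2 * \<sigma> * t) * V\<close> grows at
  most by the factor \<open>B\<close>: the trigger allows \<open>1 + A / K1\<close>, the change of the parameter in \<open>V\<close>
  costs \<open>K2 / K1\<close>, and the interval is no longer than \<open>T\<close>.\<close>

definition B :: real where "B = K2 / K1 * (1 + A / K1) * exp (2 * \<sigma> * T)"

lemma ratio_ge_1: "1 \<le> K2 / K1" and jump_ge_1: "1 \<le> 1 + A / K1" and exp_ge_1: "1 \<le> exp (2 * \<sigma> * T)"
  using K1 K2 A \<sigma> T by simp_all

lemma exp_jump_le_B: "exp (2 * \<sigma> * T) * (1 + A / K1) \<le> B"
proof -
  have "1 * (exp (2 * \<sigma> * T) * (1 + A / K1)) \<le> K2 / K1 * (exp (2 * \<sigma> * T) * (1 + A / K1))"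
    by (rule mult_right_mono[OF ratio_ge_1]) (use jump_ge_1 in simp)
  then show ?thesis by (simp add: B_def mult_ac)
qed

lemma jump_le_B: "1 + A / K1 \<le> B"
proof -
  have "1 * (1 + A / K1) \<le> exp (2 * \<sigma> * T) * (1 + A / K1)"
    by (rule mult_right_mono[OF exp_ge_1]) (use jump_ge_1 in linarith)
  then show ?thesis using exp_jump_le_B by (simp only: mult_1_left)
qed

lemma B_ge_1: "1 \<le> B"
  using jump_le_B jump_ge_1 by linarith

section \<open>Control of V on a single inter-event interval\<close>

lemma V_nonneg_near:
  assumes "\<eta> \<in> \<Theta>" "norm (\<eta> - \<theta>) \<le> r0" "norm y \<le> \<rho>"
  shows "0 \<le> V (\<eta>, y)"
proof -
  have "0 \<le> K1 * (norm y)\<^sup>2" using K1 by simp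
  then show ?thesis using lower[OF assms] by linarith
qed

text \<open>The quadratic bound on \<open>a\<close> and the lower bound on \<open>V\<close> make the
  trigger level proportional to \<open>V\<close>; this is where the growth condition on
  \<open>a\<close> near 0 enters.\<close>

lemma trigger_level_le:
  assumes "\<eta> \<in> \<Theta>" "norm (\<eta> - \<theta>) \<le> r0" "norm y \<le> \<rho>"
  shows "V (\<eta>, y) + a y \<le> (1 + A / K1) * V (\<eta>, y)"
proof -
  have "A * (norm y)\<^sup>2 = A / K1 * (K1 * (norm y)\<^sup>2)" using K1 by simp
  also have "\<dots> \<le> A / K1 * V (\<eta>, y)"
    by (rule mult_left_mono[OF lower[OF assms]]) (use A K1 in simp)
  finally show ?thesis using threshold[OF assms(3)] by (simp add: distrib_right)
qed

text \<open>The trigger bounds \<open>V\<close> on the whole interval by data at its start. On the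
  sphere of radius \<open>\<rho>\<close> the bound \<open>lower\<close> would force \<open>V\<close>
  up to \<open>K1 * \<rho>\<^sup>2\<close>, which \<open>small\<close> rules out; by continuity the
  state therefore stays inside, where \<open>lower\<close> remains available.\<close>

lemma interval_bound:
  assumes p: "partial_sol n x \<theta>h \<tau>" and i: "i < n"
    and r0: "norm (\<theta>h (\<tau> i) - \<theta>) \<le> r0" and xi: "norm (x (\<tau> i)) < \<rho>"
    and small: "(1 + A / K1) * V (\<theta>h (\<tau> i), x (\<tau> i)) < K1 * \<rho>\<^sup>2"
    and t: "t \<in> {\<tau> i..\<tau> (Suc i)}"
  shows "norm (x t) < \<rho>" and "V (\<theta>h (\<tau> i), x t) \<le> (1 + A / K1) * V (\<theta>h (\<tau> i), x (\<tau> i))"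
proof -
  note tr = partial_solD(1)[OF p]
  note \<eta> = trajectoryD(4)[OF tr i]
  have bound: "V (\<theta>h (\<tau> i), x t) \<le> (1 + A / K1) * V (\<theta>h (\<tau> i), x (\<tau> i))"
    if t: "t \<in> {\<tau> i..\<tau> (Suc i)}" for t
  proof -
    have "V (\<theta>h (\<tau> i), x t) \<le> V (\<theta>h (\<tau> i), x (\<tau> i)) + a (x (\<tau> i))"
      by (rule trigger_step_le[OF lip[OF \<eta>] equilibrium[OF \<eta>] V[OF \<eta>] a trajectoryD(6)[OF tr i]
            trajectory_piece_continuous[OF tr i] trajectoryD(2)[OF tr i] partial_solD(3)[OF p i] t])
    also have "\<dots> \<le> (1 + A / K1) * V (\<theta>h (\<tau> i), x (\<tau> i))"
      by (rule trigger_level_le[OF \<eta> r0]) (use xi in simp)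
    finally show ?thesis .
  qed
  show "V (\<theta>h (\<tau> i), x t) \<le> (1 + A / K1) * V (\<theta>h (\<tau> i), x (\<tau> i))" by (rule bound[OF t])
  show "norm (x t) < \<rho>"
  proof (rule ccontr)
    assume "\<not> ?thesis"
    then have ge: "\<rho> \<le> norm (x t)" by simp
    have "continuous_on {\<tau> i..t} x"
      by (rule continuous_on_subset[OF trajectory_piece_continuous[OF tr i]]) (use t in auto)
    then have "continuous_on {\<tau> i..t} (\<lambda>t. norm (x t))" by (rule continuous_on_norm)
    from IVT'[OF _ ge _ this] xi t obtain u where u: "\<tau> i \<le> u" "u \<le> t" "norm (x u) = \<rho>"
      by auto
    have "K1 * \<rho>\<^sup>2 \<le> V (\<theta>h (\<tau> i), x u)" using lower[OF \<eta> r0, of "x u"] u by simp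
    also have "\<dots> \<le> (1 + A / K1) * V (\<theta>h (\<tau> i), x (\<tau> i))" by (rule bound) (use u t in auto)
    finally show False using small by linarith
  qed
qed

lemma interval_length:
  assumes p: "partial_sol n x \<theta>h \<tau>" and i: "i < n"
  shows "\<tau> (Suc i) \<le> \<tau> i + T"
proof -
  note tr = partial_solD(1)[OF p]
  note \<eta> = trajectoryD(4)[OF tr i]
  show ?thesis
    by (rule trigger_step_length[OF lip[OF \<eta>] equilibrium[OF \<eta>] V[OF \<eta>] a trajectoryD(6)[OF tr i]
          trajectory_piece_continuous[OF tr i] trajectoryD(2)[OF tr i] partial_solD(3)[OF p i]])
qed

text \<open>Without an update the plant is indistinguishable from the one with parameter
  \<open>\<theta>h (\<tau> i)\<close>, for which \<open>V (\<theta>h (\<tau> i), -)\<close> is a Lyapunov function.\<close>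

lemma
  assumes p: "partial_sol n x \<theta>h \<tau>" and i: "i < n" and same: "\<theta>h (\<tau> (Suc i)) = \<theta>h (\<tau> i)"
  shows no_update_decay: "t \<in> {\<tau> i..\<tau> (Suc i)} \<Longrightarrow>
      exp (2 * \<sigma> * t) * V (\<theta>h (\<tau> i), x t) \<le> exp (2 * \<sigma> * \<tau> i) * V (\<theta>h (\<tau> i), x (\<tau> i))"
    and no_update_length: "0 \<le> V (\<theta>h (\<tau> i), x (\<tau> i)) \<Longrightarrow> \<tau> (Suc i) = \<tau> i + T"
proof -
  note tr = partial_solD(1)[OF p]
  note \<eta> = trajectoryD(4)[OF tr i]
  have lt: "\<tau> i < \<tau> (Suc i)" by (rule trajectoryD(2)[OF tr i])
  have un: "\<theta>h (\<tau> i) - \<theta> \<in> unexcited x \<theta>h (\<tau> (Suc i))"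
    using update_feasible[OF p i] unfolding same .
  have indist: "g (x r, k (\<theta>h (\<tau> i), x r)) *v (\<theta>h (\<tau> i) - \<theta>) = 0" if r: "r \<in> {\<tau> i..<\<tau> (Suc i)}" for r
  proof -
    have "0 \<le> \<tau> i" by (rule trajectory_nonneg[OF tr]) (use i in simp)
    then have "g (x r, k (\<theta>h r, x r)) *v (\<theta>h (\<tau> i) - \<theta>) = 0"
      using un r unfolding unexcited_def by simp
    then show ?thesis unfolding trajectoryD(5)[OF tr i r] .
  qed
  have decay: "exp (2 * \<sigma> * t) * V (\<theta>h (\<tau> i), x t) \<le> exp (2 * \<sigma> * \<tau> i) * V (\<theta>h (\<tau> i), x (\<tau> i))"
    if "t \<in> {\<tau> i..\<tau> (Suc i)}" for t
    by (rule lyapunov_decay[OF \<eta> diff[OF \<eta>] H1[OF \<eta>] trajectoryD(6)[OF tr i]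
          trajectory_piece_continuous[OF tr i] indist that])
  then show "t \<in> {\<tau> i..\<tau> (Suc i)} \<Longrightarrow>
      exp (2 * \<sigma> * t) * V (\<theta>h (\<tau> i), x t) \<le> exp (2 * \<sigma> * \<tau> i) * V (\<theta>h (\<tau> i), x (\<tau> i))" .
  assume nonneg: "0 \<le> V (\<theta>h (\<tau> i), x (\<tau> i))"
  show "\<tau> (Suc i) = \<tau> i + T"
  proof (rule ccontr)
    assume "\<not> ?thesis"
    then have less: "\<tau> (Suc i) < \<tau> i + T" using interval_length[OF p i] by simp
    \<comment> \<open>An interval shorter than \<open>T\<close> was ended by the trigger, so
      \<open>V\<close> has risen by \<open>a (x (\<tau> i)) > 0\<close>, contrary to the
      decay.\<close>
    have eq: "x (\<tau> i) \<noteq> 0 \<and> V (\<theta>h (\<tau> i), x (\<tau> (Suc i))) = V (\<theta>h (\<tau> i), x (\<tau> i)) + a (x (\<tau> i))"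
      by (rule trigger_step_eq[OF lip[OF \<eta>] equilibrium[OF \<eta>] V[OF \<eta>] a trajectoryD(6)[OF tr i]
            trajectory_piece_continuous[OF tr i] lt partial_solD(3)[OF p i] less])
    then have "0 < a (x (\<tau> i))" using a unfolding pos_def_fun_def by blast
    with eq have gt: "V (\<theta>h (\<tau> i), x (\<tau> i)) < V (\<theta>h (\<tau> i), x (\<tau> (Suc i)))" by simp
    have "exp (2 * \<sigma> * \<tau> i) * V (\<theta>h (\<tau> i), x (\<tau> i)) < exp (2 * \<sigma> * \<tau> i) * V (\<theta>h (\<tau> i), x (\<tau> (Suc i)))"
      using gt by simp
    also have "\<dots> \<le> exp (2 * \<sigma> * \<tau> (Suc i)) * V (\<theta>h (\<tau> i), x (\<tau> (Suc i)))"
      by (rule mult_right_mono) (use gt nonneg lt \<sigma> in simp_all)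
    also have "\<dots> \<le> exp (2 * \<sigma> * \<tau> i) * V (\<theta>h (\<tau> i), x (\<tau> i))" by (rule decay) (use lt in simp)
    finally show False by simp
  qed
qed

text \<open>\<open>CARD('l)\<close> minus the dimension is the number of directions excited so far,
  an upper bound on the number of updates. For each such direction the third conjunct grants one
  factor \<open>B\<close> and the last one grants one interval shorter than \<open>T\<close>.
  Truncated subtraction is harmless by \<open>dim_unexcited_le\<close>.\<close>

definition invariant :: "real \<Rightarrow> (real \<Rightarrow> real^'n) \<Rightarrow> (real \<Rightarrow> real^'l) \<Rightarrow> (nat \<Rightarrow> real) \<Rightarrow> nat \<Rightarrow> bool"
  where "invariant C x \<theta>h \<tau> i \<longleftrightarrow>
    norm (\<theta>h (\<tau> i) - \<theta>) \<le> r0 \<and> norm (x (\<tau> i)) < \<rho> \<and>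
    exp (2 * \<sigma> * \<tau> i) * V (\<theta>h (\<tau> i), x (\<tau> i)) \<le> B ^ (CARD('l) - dim (unexcited x \<theta>h (\<tau> i))) * C \<and>
    T * i \<le> \<tau> i + T * (CARD('l) - dim (unexcited x \<theta>h (\<tau> i)))"

text \<open>Origin of the exponent \<open>Suc CARD('l)\<close>: at most \<open>CARD('l)\<close>
  factors for past updates, and one more for the growth within the interval that starts at
  \<open>\<tau> i\<close>.\<close>

lemma invariant_level:
  assumes p: "partial_sol n x \<theta>h \<tau>" and i: "i \<le> n" and inv: "invariant C x \<theta>h \<tau> i" and C: "0 \<le> C"
  shows "0 \<le> V (\<theta>h (\<tau> i), x (\<tau> i))"
    and "exp (2 * \<sigma> * \<tau> i) * (B * V (\<theta>h (\<tau> i), x (\<tau> i))) \<le> B ^ Suc CARD('l) * C"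
    and "(1 + A / K1) * V (\<theta>h (\<tau> i), x (\<tau> i)) \<le> B ^ Suc CARD('l) * C"
proof -
  let ?V = "V (\<theta>h (\<tau> i), x (\<tau> i))" and ?E = "exp (2 * \<sigma> * \<tau> i)"
  let ?j = "CARD('l) - dim (unexcited x \<theta>h (\<tau> i))"
  have inv': "norm (\<theta>h (\<tau> i) - \<theta>) \<le> r0" "norm (x (\<tau> i)) < \<rho>" "?E * ?V \<le> B ^ ?j * C"
    using inv unfolding invariant_def by blast+
  show V0: "0 \<le> ?V"
    by (rule V_nonneg_near[OF partial_solD(2)[OF p i] inv'(1)]) (use inv'(2) in simp)
  have "?E * (B * ?V) = B * (?E * ?V)" by simp
  also have "\<dots> \<le> B * (B ^ ?j * C)" by (rule mult_left_mono[OF inv'(3)]) (use B_ge_1 in simp)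
  also have "\<dots> = B ^ Suc ?j * C" by simp
  also have "\<dots> \<le> B ^ Suc CARD('l) * C"
    by (intro mult_right_mono power_increasing B_ge_1 C) simp
  finally show EB: "?E * (B * ?V) \<le> B ^ Suc CARD('l) * C" .
  have "1 \<le> ?E" using \<sigma> trajectory_nonneg[OF partial_solD(1)[OF p] i] by simp
  then have "1 * (B * ?V) \<le> ?E * (B * ?V)" by (rule mult_right_mono) (use V0 B_ge_1 in simp)
  moreover have "(1 + A / K1) * ?V \<le> B * ?V" by (rule mult_right_mono[OF jump_le_B V0])
  ultimately show "(1 + A / K1) * ?V \<le> B ^ Suc CARD('l) * C" using EB by linarith
qed

text \<open>Without an update the weighted \<open>V\<close> does not grow and the interval lasts
  exactly \<open>T\<close>. With an update it may grow by \<open>B\<close> and the interval may be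
  short, but the number of excited directions rises, which pays for both.\<close>

lemma invariant_step:
  assumes p: "partial_sol n x \<theta>h \<tau>" and i: "i < n" and inv: "invariant C x \<theta>h \<tau> i" and C: "0 \<le> C"
    and small: "B ^ Suc CARD('l) * C < K1 * \<rho>\<^sup>2"
  shows "invariant C x \<theta>h \<tau> (Suc i)"
proof -
  let ?V = "V (\<theta>h (\<tau> i), x (\<tau> i))" and ?V' = "V (\<theta>h (\<tau> (Suc i)), x (\<tau> (Suc i)))"
  let ?E = "exp (2 * \<sigma> * \<tau> i)" and ?E' = "exp (2 * \<sigma> * \<tau> (Suc i))"
  let ?d = "dim (unexcited x \<theta>h (\<tau> i))" and ?d' = "dim (unexcited x \<theta>h (\<tau> (Suc i)))"
  have inv': "norm (\<theta>h (\<tau> i) - \<theta>) \<le> r0" "norm (x (\<tau> i)) < \<rho>" "?E * ?V \<le> B ^ (CARD('l) - ?d) * C"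
    "T * i \<le> \<tau> i + T * (CARD('l) - ?d)"
    using inv unfolding invariant_def by blast+
  note tr = partial_solD(1)[OF p]
  have lt: "\<tau> i < \<tau> (Suc i)" by (rule trajectoryD(2)[OF tr i])
  have iS: "Suc i \<le> n" and i': "i \<le> n" using i by simp_all
  note level = invariant_level[OF p i' inv C]
  have small': "(1 + A / K1) * ?V < K1 * \<rho>\<^sup>2" using level(3) small by linarith
  have in': "\<tau> (Suc i) \<in> {\<tau> i..\<tau> (Suc i)}" using lt by simp
  note bound = interval_bound[OF p i inv'(1,2) small' in']
  have r0: "norm (\<theta>h (\<tau> (Suc i)) - \<theta>) \<le> r0" using update_contracts[OF p i] inv'(1) by linarith
  have dd: "?d' \<le> ?d" by (rule dim_unexcited_antimono) (use lt in simp)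
  have dl: "?d \<le> CARD('l)" by (rule dim_unexcited_le)
  have "?E' * ?V' \<le> B ^ (CARD('l) - ?d') * C \<and> T * Suc i \<le> \<tau> (Suc i) + T * (CARD('l) - ?d')"
  proof (cases "\<theta>h (\<tau> (Suc i)) = \<theta>h (\<tau> i)")
    case True
    have "?E' * ?V' \<le> ?E * ?V" using no_update_decay[OF p i True in'] unfolding True .
    also have "\<dots> \<le> B ^ (CARD('l) - ?d) * C" by (rule inv'(3))
    also have "\<dots> \<le> B ^ (CARD('l) - ?d') * C"
      by (intro mult_right_mono power_increasing B_ge_1 C) (use dd in simp)
    finally have 1: "?E' * ?V' \<le> B ^ (CARD('l) - ?d') * C" .
    have "T * (CARD('l) - ?d) \<le> T * (CARD('l) - ?d')"
      by (rule mult_left_mono) (use dd T in simp_all)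
    then have "T * Suc i \<le> \<tau> (Suc i) + T * (CARD('l) - ?d')"
      using inv'(4) no_update_length[OF p i True level(1)] by (simp add: distrib_left)
    with 1 show ?thesis ..
  next
    case False
    have ddl: "Suc (CARD('l) - ?d) \<le> CARD('l) - ?d'"
      using dim_unexcited_less[OF p i False] dl by simp
    have "?V' \<le> K2 * (norm (x (\<tau> (Suc i))))\<^sup>2"
      by (rule upper[OF partial_solD(2)[OF p iS] r0]) (use bound(1) in simp)
    also have "\<dots> = K2 / K1 * (K1 * (norm (x (\<tau> (Suc i))))\<^sup>2)" using K1 by simp
    also have "\<dots> \<le> K2 / K1 * V (\<theta>h (\<tau> i), x (\<tau> (Suc i)))"
      by (rule mult_left_mono[OF lower[OF partial_solD(2)[OF p i'] inv'(1)]])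
        (use bound(1) K1 K2 in simp_all)
    also have "\<dots> \<le> K2 / K1 * ((1 + A / K1) * ?V)"
      by (rule mult_left_mono[OF bound(2)]) (use K1 K2 in simp)
    finally have V': "?V' \<le> K2 / K1 * ((1 + A / K1) * ?V)" .
    have "?E' \<le> exp (2 * \<sigma> * T) * ?E"
      using interval_length[OF p i] \<sigma> by (simp flip: exp_add distrib_left)
    then have "?E' * ?V' \<le> (exp (2 * \<sigma> * T) * ?E) * (K2 / K1 * ((1 + A / K1) * ?V))"
      by (rule mult_mono[OF _ V'])
        (use V_nonneg_near[OF partial_solD(2)[OF p iS] r0] bound(1) in simp_all)
    also have "\<dots> = B * (?E * ?V)" by (simp add: B_def mult_ac)
    also have "\<dots> \<le> B * (B ^ (CARD('l) - ?d) * C)"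
      by (rule mult_left_mono[OF inv'(3)]) (use B_ge_1 in simp)
    also have "\<dots> = B ^ Suc (CARD('l) - ?d) * C" by simp
    also have "\<dots> \<le> B ^ (CARD('l) - ?d') * C"
      by (intro mult_right_mono power_increasing ddl B_ge_1 C)
    finally have 1: "?E' * ?V' \<le> B ^ (CARD('l) - ?d') * C" .
    have "T * Suc (CARD('l) - ?d) \<le> T * (CARD('l) - ?d')"
      by (rule mult_left_mono) (use ddl T in \<open>simp_all only: of_nat_le_iff less_imp_le\<close>)
    then have "T * Suc i \<le> \<tau> (Suc i) + T * (CARD('l) - ?d')"
      using inv'(4) lt by (simp add: distrib_left)
    with 1 show ?thesis ..
  qed
  then show ?thesis unfolding invariant_def using r0 bound(1) by blast
qed

section \<open>Bounds over all steps, and construction of the solution\<close>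

lemma invariant_holds:
  assumes p: "partial_sol n x \<theta>h \<tau>" and "i \<le> n"
    and r0: "norm (\<theta>h 0 - \<theta>) \<le> r0" and x0: "norm (x 0) < \<rho>"
    and small: "B ^ Suc CARD('l) * (K2 * (norm (x 0))\<^sup>2) < K1 * \<rho>\<^sup>2"
  shows "invariant (K2 * (norm (x 0))\<^sup>2) x \<theta>h \<tau> i"
  using \<open>i \<le> n\<close>
proof (induction i)
  case 0
  have t0: "\<tau> 0 = 0" by (rule trajectoryD(1)[OF partial_solD(1)[OF p]])
  have un: "unexcited x \<theta>h 0 = UNIV" by (simp add: unexcited_def)
  have "\<theta>h 0 \<in> \<Theta>" using partial_solD(2)[OF p, of 0] t0 by simp
  from upper[OF this r0, of "x 0"] have "V (\<theta>h 0, x 0) \<le> K2 * (norm (x 0))\<^sup>2" using x0 by simp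
  then show ?case unfolding invariant_def t0 un using r0 x0 by simp
next
  case (Suc i)
  have C: "0 \<le> K2 * (norm (x 0))\<^sup>2" using K1 K2 by simp
  show ?case
    by (rule invariant_step[OF p _ _ C small]) (use Suc in simp_all)
qed

text \<open>In the constant, \<open>K2\<close> comes from \<open>V\<close> at the initial state,
  \<open>1 / K1\<close> from converting \<open>V\<close> back to the norm, and the power of
  \<open>B\<close> from the growth in between. The square root halves the rate
  \<open>2 * \<sigma>\<close>.\<close>

lemma exponential_bound:
  assumes p: "partial_sol n x \<theta>h \<tau>"
    and r0: "norm (\<theta>h 0 - \<theta>) \<le> r0" and x0: "norm (x 0) < \<rho>"
    and small: "B ^ Suc CARD('l) * (K2 * (norm (x 0))\<^sup>2) < K1 * \<rho>\<^sup>2"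
    and t: "0 \<le> t" "t < \<tau> n"
  shows "norm (x t) \<le> sqrt (B ^ Suc CARD('l) * K2 / K1) * exp (- \<sigma> * t) * norm (x 0)"
proof -
  note tr = partial_solD(1)[OF p]
  let ?C = "K2 * (norm (x 0))\<^sup>2"
  have C: "0 \<le> ?C" using K1 K2 by simp
  have "\<tau> 0 \<le> t" using trajectoryD(1)[OF tr] t by simp
  then obtain i where i: "i < n" "\<tau> i \<le> t" "t < \<tau> (Suc i)" using t(2) by (rule strict_mono_cover)
  then have i': "i \<le> n" and ti: "t \<in> {\<tau> i..\<tau> (Suc i)}" by simp_all
  note inv = invariant_holds[OF p i' r0 x0 small]
  note level = invariant_level[OF p i' inv C]
  have inv': "norm (\<theta>h (\<tau> i) - \<theta>) \<le> r0" "norm (x (\<tau> i)) < \<rho>"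
    using inv unfolding invariant_def by blast+
  have small': "(1 + A / K1) * V (\<theta>h (\<tau> i), x (\<tau> i)) < K1 * \<rho>\<^sup>2" using level(3) small by linarith
  note bound = interval_bound[OF p i(1) inv' small' ti]
  let ?V = "V (\<theta>h (\<tau> i), x (\<tau> i))" and ?E = "exp (2 * \<sigma> * \<tau> i)"
  have "exp (2 * \<sigma> * t) \<le> exp (2 * \<sigma> * T) * ?E"
    using interval_length[OF p i(1)] i \<sigma> by (simp flip: exp_add distrib_left)
  then have "exp (2 * \<sigma> * t) * (K1 * (norm (x t))\<^sup>2) \<le> (exp (2 * \<sigma> * T) * ?E) * ((1 + A / K1) * ?V)"
  proof (rule mult_mono)
    have "K1 * (norm (x t))\<^sup>2 \<le> V (\<theta>h (\<tau> i), x t)"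
      by (rule lower[OF partial_solD(2)[OF p i'] inv'(1)]) (use bound(1) in simp)
    then show "K1 * (norm (x t))\<^sup>2 \<le> (1 + A / K1) * ?V" using bound(2) by linarith
  qed (use K1 in simp_all)
  also have "\<dots> = ?E * ((exp (2 * \<sigma> * T) * (1 + A / K1)) * ?V)" by (simp add: mult_ac)
  also have "\<dots> \<le> ?E * (B * ?V)"
    by (intro mult_left_mono mult_right_mono exp_jump_le_B level(1)) simp
  also have "\<dots> \<le> B ^ Suc CARD('l) * ?C" by (rule level(2))
  finally have "(exp (\<sigma> * t) * norm (x t))\<^sup>2 \<le> B ^ Suc CARD('l) * K2 / K1 * (norm (x 0))\<^sup>2"
    using K1 by (simp add: field_simps power_mult_distrib flip: exp_double)
  also have "\<dots> = (sqrt (B ^ Suc CARD('l) * K2 / K1) * norm (x 0))\<^sup>2"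
    using K1 K2 B_ge_1 by (simp add: power_mult_distrib)
  finally have "exp (\<sigma> * t) * norm (x t) \<le> sqrt (B ^ Suc CARD('l) * K2 / K1) * norm (x 0)"
    by (rule power2_le_imp_le) (use K1 K2 B_ge_1 in simp)
  then have "exp (- \<sigma> * t) * (exp (\<sigma> * t) * norm (x t)) \<le>
      exp (- \<sigma> * t) * (sqrt (B ^ Suc CARD('l) * K2 / K1) * norm (x 0))"
    by (rule mult_left_mono) simp
  moreover have "exp (- \<sigma> * t) * (exp (\<sigma> * t) * norm (x t)) = norm (x t)"
    by (simp add: exp_minus)
  ultimately have "norm (x t) \<le> exp (- \<sigma> * t) * (sqrt (B ^ Suc CARD('l) * K2 / K1) * norm (x 0))"
    by (simp only:)
  then show ?thesis by (simp only: mult_ac)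
qed

text \<open>Excludes accumulation of event times: all intervals except at most
  \<open>CARD('l)\<close> have length \<open>T\<close>.\<close>

lemma event_time_lower:
  assumes p: "partial_sol n x \<theta>h \<tau>"
    and r0: "norm (\<theta>h 0 - \<theta>) \<le> r0" and x0: "norm (x 0) < \<rho>"
    and small: "B ^ Suc CARD('l) * (K2 * (norm (x 0))\<^sup>2) < K1 * \<rho>\<^sup>2"
  shows "T * n - T * CARD('l) \<le> \<tau> n"
proof -
  let ?d = "dim (unexcited x \<theta>h (\<tau> n))"
  have "T * n \<le> \<tau> n + T * (CARD('l) - ?d)"
    using invariant_holds[OF p order_refl r0 x0 small] unfolding invariant_def by blast
  moreover have "T * (CARD('l) - ?d) \<le> T * CARD('l)"
    by (rule mult_left_mono) (use T in simp_all)
  ultimately show ?thesis by linarith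
qed

text \<open>The plant is followed until time \<open>s + T\<close> or until the sphere of radius
  \<open>\<rho>\<close>. On the sphere \<open>V\<close> exceeds the trigger level by
  \<open>small\<close>, so an event occurs no later than that, while the solution still
  exists.\<close>

lemma partial_sol_extend:
  assumes p: "partial_sol n x \<theta>h \<tau>"
    and r0: "norm (\<theta>h (\<tau> n) - \<theta>) \<le> r0" and xn: "norm (x (\<tau> n)) < \<rho>"
    and small: "(1 + A / K1) * V (\<theta>h (\<tau> n), x (\<tau> n)) < K1 * \<rho>\<^sup>2"
  shows "\<exists>x' \<theta>h' \<tau>'. partial_sol (Suc n) x' \<theta>h' \<tau>' \<and> x' 0 = x 0 \<and> \<theta>h' 0 = \<theta>h 0"
proof -
  note tr = partial_solD(1)[OF p]
  define s where "s = \<tau> n"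
  define \<eta> where "\<eta> = \<theta>h s"
  let ?F = "loop_field f g k \<theta> \<eta>" and ?W = "\<lambda>y. V (\<eta>, y)"
  have s0: "0 \<le> s" unfolding s_def by (rule trajectory_nonneg[OF tr order_refl])
  have \<eta>: "\<eta> \<in> \<Theta>" using partial_solD(2)[OF p order_refl] by (simp add: \<eta>_def s_def)
  have near: "norm (\<eta> - \<theta>) \<le> r0" using r0 by (simp add: \<eta>_def s_def)
  have xs: "norm (x s) < \<rho>" using xn by (simp add: s_def)
  obtain y e where y: "s < e" "e \<le> s + T" "ode_solution ?F {s..e} y" "y s = x s"
    "e = s + T \<or> norm (y e) = \<rho>"
    by (rule ode_solution_until_exit[OF lip[OF \<eta>] xs T])
  have cy: "continuous_on {s..e} y" by (rule ode_solution_continuous_on[OF y(3)])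
  have "e = s + T \<or> y s \<noteq> 0 \<and> V (\<eta>, y e) \<ge> V (\<eta>, y s) + a (y s)"
  proof (cases "e = s + T")
    case False
    then have ye: "norm (y e) = \<rho>" using y(5) by simp
    \<comment> \<open>The zero solution never reaches the sphere, so a start at 0, for which the
      trigger is replaced by the time limit, cannot lead here.\<close>
    have "y s \<noteq> 0"
    proof
      assume "y s = 0"
      have "y e = (\<lambda>_. 0) e"
        by (rule ode_solution_unique[OF lip[OF \<eta>] ode_solution_subset[OF y(3) ico_subset] cy])
          (use y(1) \<open>y s = 0\<close> equilibrium[OF \<eta>] in \<open>simp_all add: ode_solution_def\<close>)
      then show False using ye \<rho> by simp
    qed
    moreover have "V (\<eta>, y s) + a (y s) \<le> (1 + A / K1) * V (\<eta>, y s)"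
      by (rule trigger_level_le[OF \<eta> near]) (use xs y(4) in simp)
    moreover have "K1 * \<rho>\<^sup>2 \<le> V (\<eta>, y e)" using lower[OF \<eta> near, of "y e"] ye by simp
    ultimately show ?thesis using small y(4) by (simp add: \<eta>_def s_def)
  qed simp
  from trigger_exists[OF lip[OF \<eta>] V[OF \<eta>] a T y(3,1,2) this]
  obtain b where b: "s < b" "b \<le> e"
    "ereal b = min (ereal (s + T)) (trigger_time ?F ?W a T s (x s))"
    unfolding y(4) by blast
  define x' where "x' t = (if t \<le> s then x t else y t)" for t
  \<comment> \<open>The estimate \<open>\<zeta>\<close> that takes over at \<open>b\<close> is kept
    as a parameter: it is to be chosen from a feasible set that is computed along the extended
    trajectory itself.\<close>
  define H where "H \<zeta> t = (if t < s then \<theta>h t else if t < b then \<eta> else \<zeta>)" for \<zeta> t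
  define \<tau>' where "\<tau>' = \<tau>(Suc n := b)"
  have \<tau>': "\<tau>' n = s" "\<tau>' (Suc n) = b" by (simp_all add: \<tau>'_def s_def)
  have x'y: "x' t = y t" if "t \<in> {s..b}" for t
  proof -
    have "t = s \<or> s < t" using that by auto
    then show ?thesis using y(4) by (auto simp: x'_def)
  qed
  have H: "H \<zeta> s = \<eta>" "H \<zeta> b = \<zeta>" for \<zeta> using b(1) by (simp_all add: H_def)
  have x's: "x' s = x s" by (simp add: x'_def)
  have H_before: "H \<zeta> t = \<theta>h t" if "t \<le> s" for \<zeta> t
    using b(1) order_le_imp_less_or_eq[OF that] by (auto simp: H_def \<eta>_def)
  have p': "partial_sol n x' (H \<zeta>) \<tau>'" for \<zeta>
    by (rule partial_sol_cong[OF p])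
      (simp_all add: \<tau>'_def x'_def H_before flip: s_def)
  have cx': "continuous_on {s..b} x'"
    by (subst continuous_on_cong[OF refl x'y]) (use continuous_on_subset[OF cy] b(2) in simp_all)
  have const: "H \<zeta> t = \<eta>" if "t \<in> {s..<b}" for \<zeta> t using that by (simp add: H_def)
  have ode: "ode_solution ?F {s..<b} x'"
    by (rule ode_solution_cong[OF ode_solution_subset[OF y(3)]]) (use b(2) x'y in auto)
  have "trajectory (Suc n) x' (H \<zeta>) \<tau>'" for \<zeta>
    by (rule trajectory_SucI[OF partial_solD(1)[OF p']], unfold \<tau>' H) (fact b(1) cx' \<eta> const ode)+
  note feasible = feasible_iff[OF this zero_less_Suc, unfolded \<tau>']
  define S where "S = {\<zeta>\<in>\<Theta>. \<zeta> - \<theta> \<in> unexcited x' (H \<eta>) b}"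
  \<comment> \<open>Here the circularity disappears: before \<open>b\<close> the signal
    \<open>H \<zeta>\<close> does not depend on \<open>\<zeta>\<close>, hence neither does the
    feasible set.\<close>
  have unexcited_eq: "unexcited x' (H \<zeta>) b = unexcited x' (H \<eta>) b" for \<zeta>
    by (simp add: unexcited_def H_def)
  have feasible_eq: "lsq_feasible \<Theta> f g x' (\<lambda>t. k (H \<zeta> t, x' t)) b = S" for \<zeta>
    unfolding feasible S_def by (simp only: unexcited_eq[of \<zeta>])
  define \<zeta> where "\<zeta> = closest_point S \<eta>"
  have "S \<noteq> {}" unfolding S_def using true_parameter_feasible by blast
  then have lsq: "is_unique_arg_min (\<lambda>z. (norm (z - \<eta>))\<^sup>2) S \<zeta>"
    unfolding S_def \<zeta>_def
    by (intro is_unique_arg_min_closest_point convex_feasible closed_feasible)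
  have \<zeta>: "\<zeta> \<in> \<Theta>" using is_unique_arg_minD(1)[OF lsq] unfolding S_def by blast
  have "partial_sol (Suc n) x' (H \<zeta>) \<tau>'"
    by (rule partial_sol_SucI[OF p'], unfold \<tau>' H x's feasible_eq)
      (fact b(1) cx' const ode \<zeta> b(3) lsq)+
  moreover have "x' 0 = x 0" using s0 by (simp add: x'_def)
  moreover have "H \<zeta> 0 = \<theta>h 0" using s0 b(1) by (simp add: H_def \<eta>_def)
  ultimately show ?thesis by blast
qed

lemma partial_sol_exists:
  assumes \<theta>0: "\<theta>0 \<in> \<Theta>" "norm (\<theta>0 - \<theta>) \<le> r0" and x0: "norm x0 < \<rho>"
    and small: "B ^ Suc CARD('l) * (K2 * (norm x0)\<^sup>2) < K1 * \<rho>\<^sup>2"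
  shows "\<exists>x \<theta>h \<tau>. partial_sol n x \<theta>h \<tau> \<and> x 0 = x0 \<and> \<theta>h 0 = \<theta>0"
proof (induction n)
  case 0
  show ?case
    by (intro exI[of _ "\<lambda>_. x0"] exI[of _ "\<lambda>_. \<theta>0"] exI[of _ "\<lambda>_. 0"] conjI partial_sol_0[OF \<theta>0(1)])
      (rule refl)+
next
  case (Suc n)
  then obtain x \<theta>h \<tau> where p: "partial_sol n x \<theta>h \<tau>" and x: "x 0 = x0" and \<theta>h: "\<theta>h 0 = \<theta>0" by blast
  have C: "0 \<le> K2 * (norm (x 0))\<^sup>2" using K1 K2 by simp
  have inv: "invariant (K2 * (norm (x 0))\<^sup>2) x \<theta>h \<tau> n"
    by (rule invariant_holds[OF p order_refl]) (use \<theta>0 x0 small x \<theta>h in simp_all)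
  then have "norm (\<theta>h (\<tau> n) - \<theta>) \<le> r0" "norm (x (\<tau> n)) < \<rho>" unfolding invariant_def by blast+
  moreover have "(1 + A / K1) * V (\<theta>h (\<tau> n), x (\<tau> n)) < K1 * \<rho>\<^sup>2"
    using invariant_level(3)[OF p order_refl inv C] small unfolding x by linarith
  ultimately show ?case using partial_sol_extend[OF p] unfolding x \<theta>h by blast
qed

text \<open>Since the event times are unbounded, every \<open>t \<ge> 0\<close> is reached after
  finitely many steps, so the bound and uniqueness carry over from partial solutions.\<close>

lemma hybrid_solution_exponential:
  assumes \<theta>0: "\<theta>0 \<in> \<Theta>" "norm (\<theta>0 - \<theta>) \<le> r0" and x0: "norm x0 < \<rho>"
    and small: "B ^ Suc CARD('l) * (K2 * (norm x0)\<^sup>2) < K1 * \<rho>\<^sup>2"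
  shows "\<exists>x \<theta>h \<tau>.
    hybrid_solution \<Theta> f g k V a T \<theta> x \<theta>h \<tau> \<and> x 0 = x0 \<and> \<theta>h 0 = \<theta>0 \<and>
    (\<forall>x' \<theta>h' \<tau>'.
      hybrid_solution \<Theta> f g k V a T \<theta> x' \<theta>h' \<tau>' \<and> x' 0 = x0 \<and> \<theta>h' 0 = \<theta>0 \<longrightarrow>
        \<tau>' = \<tau> \<and> (\<forall>t\<ge>0. x' t = x t \<and> \<theta>h' t = \<theta>h t)) \<and>
    filterlim \<tau> at_top sequentially \<and>
    (\<forall>t\<ge>0. norm (x t) \<le> sqrt (B ^ Suc CARD('l) * K2 / K1) * exp (- \<sigma> * t) * norm x0)"
proof -
  obtain x \<theta>h \<tau> where p: "\<And>n. partial_sol n x \<theta>h \<tau>" and x: "x 0 = x0" and \<theta>h: "\<theta>h 0 = \<theta>0"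
    by (rule hybrid_solution_glue[OF partial_sol_exists[OF assms]]) blast
  have "filterlim (\<lambda>n. - (T * CARD('l)) + T * real n) at_top sequentially"
    by (intro filterlim_tendsto_add_at_top[OF tendsto_const]
        filterlim_tendsto_pos_mult_at_top[OF tendsto_const T] filterlim_real_sequentially)
  moreover have "- (T * CARD('l)) + T * real n \<le> \<tau> n" for n
    using event_time_lower[OF p[of n]] \<theta>0 x0 small unfolding x \<theta>h by simp
  ultimately have lim: "filterlim \<tau> at_top sequentially"
    by (intro filterlim_at_top_mono[where g = \<tau>] always_eventually allI)
  have unbounded: "\<exists>n. t < \<tau> n" for t
    using lim unfolding filterlim_at_top_dense eventually_sequentially by blast
  have "norm (x t) \<le> sqrt (B ^ Suc CARD('l) * K2 / K1) * exp (- \<sigma> * t) * norm x0" if t: "0 \<le> t" for t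
  proof -
    obtain n where "t < \<tau> n" using unbounded by blast
    from exponential_bound[OF p _ _ _ t this] show ?thesis
      using \<theta>0 x0 small unfolding x \<theta>h by blast
  qed
  moreover have "\<tau>' = \<tau> \<and> (\<forall>t\<ge>0. x' t = x t \<and> \<theta>h' t = \<theta>h t)"
    if "hybrid_solution \<Theta> f g k V a T \<theta> x' \<theta>h' \<tau>'" "x' 0 = x0" "\<theta>h' 0 = \<theta>0" for x' \<theta>h' \<tau>'
  proof -
    have p': "\<And>n. partial_sol n x' \<theta>h' \<tau>'" using that(1) unfolding hybrid_solution_iff by blast
    have agree: "(\<forall>i\<le>n. \<tau> i = \<tau>' i) \<and> (\<forall>t\<in>{0..\<tau> n}. x t = x' t \<and> \<theta>h t = \<theta>h' t)" for n
      by (rule partial_sol_unique[OF p p']) (simp_all add: x \<theta>h that)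
    have "\<tau>' n = \<tau> n" for n using agree[of n] by simp
    moreover have "x' t = x t \<and> \<theta>h' t = \<theta>h t" if "0 \<le> t" for t
    proof -
      obtain n where "t < \<tau> n" using unbounded by blast
      then show ?thesis using agree[of n] that by simp
    qed
    ultimately show ?thesis by blast
  qed
  moreover have "hybrid_solution \<Theta> f g k V a T \<theta> x \<theta>h \<tau>" unfolding hybrid_solution_iff using p by blast
  ultimately show ?thesis using lim x \<theta>h by blast
qed

end

text \<open>\<open>hybrid_solution\<close> by itself admits accumulating event times, beyond which
  \<open>x\<close> would be arbitrary. Divergence of \<open>\<tau>\<close> gives the bound for all
  \<open>t \<ge> 0\<close> its meaning, and existence with uniqueness justifies speaking of the
  solution.\<close>

theorem theorem4p2:
  fixes \<Theta> :: "(real^'l) set"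
    and f :: "(real^'n) \<times> (real^'m) \<Rightarrow> real^'n"
    and g :: "(real^'n) \<times> (real^'m) \<Rightarrow> real^'l^'n"
    and k :: "(real^'l) \<times> (real^'n) \<Rightarrow> real^'m"
    and V :: "(real^'l) \<times> (real^'n) \<Rightarrow> real"
    and a :: "real^'n \<Rightarrow> real"
    and \<sigma> T \<delta> :: real
  assumes "closed \<Theta>" and "convex \<Theta>"
    and "smooth_map_on UNIV f" and "smooth_map_on UNIV g"
    and "f (0, 0) = 0" and "g (0, 0) = 0"
    and "smooth_map_on (\<Theta> \<times> UNIV) k" and "\<And>\<theta>. \<theta> \<in> \<Theta> \<Longrightarrow> k (\<theta>, 0) = 0"
    and "\<sigma> > 0"
    and "continuous_on (\<Theta> \<times> UNIV) V" and "\<And>\<theta> x. \<theta> \<in> \<Theta> \<Longrightarrow> 0 \<le> V (\<theta>, x)"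
    and "\<And>\<theta>. \<theta> \<in> \<Theta> \<Longrightarrow> Ck_on 1 UNIV (\<lambda>x. V (\<theta>, x))"
    and "\<And>\<theta>. \<theta> \<in> \<Theta> \<Longrightarrow> pos_def_fun (\<lambda>x. V (\<theta>, x))"
    and "\<And>\<theta>. \<theta> \<in> \<Theta> \<Longrightarrow> radially_unbounded (\<lambda>x. V (\<theta>, x))"
    and H1_stable: "\<And>\<theta>. \<theta> \<in> \<Theta> \<Longrightarrow> glob_asymp_stable (loop_field f g k \<theta> \<theta>)"
    and H1: "\<And>\<theta> x. \<theta> \<in> \<Theta> \<Longrightarrow>
      frechet_derivative (\<lambda>y. V (\<theta>, y)) (at x) (f (x, k (\<theta>, x)) + g (x, k (\<theta>, x)) *v \<theta>)
        \<le> - 2 * \<sigma> * V (\<theta>, x)"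
    and H2: "\<And>K M. \<lbrakk>K \<noteq> {}; compact K; K \<subseteq> \<Theta>; 0 \<le> M\<rbrakk> \<Longrightarrow>
      \<exists>R>0. \<forall>\<theta> x. V (\<theta>, x) \<le> M \<and> \<theta> \<in> K \<longrightarrow> norm x \<le> R"
    and "\<And>\<theta>. \<theta> \<in> \<Theta> \<Longrightarrow> loc_exp_stable (loop_field f g k \<theta> \<theta>)"
    and "\<And>K. \<lbrakk>K \<noteq> {}; compact K; K \<subseteq> \<Theta>\<rbrakk> \<Longrightarrow>
      \<exists>R K1 K2. R > 0 \<and> K2 > K1 \<and> K1 > 0 \<and>
        (\<forall>x. \<forall>\<theta>\<in>K. norm x \<le> R \<longrightarrow>
          K1 * (norm x)\<^sup>2 \<le> V (\<theta>, x) \<and> V (\<theta>, x) \<le> K2 * (norm x)\<^sup>2)"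
    and "T > 0"
    and "continuous_on UNIV a" and "\<And>x. 0 \<le> a x" and "pos_def_fun a"
    and "\<delta> > 0" and "bdd_above {a x / (norm x)\<^sup>2 | x. x \<noteq> 0 \<and> norm x \<le> \<delta>}"
  shows "\<exists>M R :: real^'l \<Rightarrow> real^'l \<Rightarrow> real.
    (\<forall>\<theta>\<in>\<Theta>. \<forall>\<eta>\<in>\<Theta>. M \<theta> \<eta> > 0 \<and> R \<theta> \<eta> > 0) \<and>
    (\<forall>\<theta>\<in>\<Theta>. \<forall>x0. \<forall>\<theta>0\<in>\<Theta>. norm x0 \<le> R \<theta> \<theta>0 \<longrightarrow>
      (\<exists>x \<theta>h \<tau>.
        hybrid_solution \<Theta> f g k V a T \<theta> x \<theta>h \<tau> \<and> x 0 = x0 \<and> \<theta>h 0 = \<theta>0 \<and>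
        (\<forall>x' \<theta>h' \<tau>'.
          hybrid_solution \<Theta> f g k V a T \<theta> x' \<theta>h' \<tau>' \<and> x' 0 = x0 \<and> \<theta>h' 0 = \<theta>0 \<longrightarrow>
            \<tau>' = \<tau> \<and> (\<forall>t\<ge>0. x' t = x t \<and> \<theta>h' t = \<theta>h t)) \<and>
        filterlim \<tau> at_top sequentially \<and>
        (\<forall>t\<ge>0. norm (x t) \<le> M \<theta> \<theta>0 * exp (- \<sigma> * t) * norm x0)))"
proof -
  define decays where "decays \<theta> \<theta>0 M x0 \<longleftrightarrow>
      (\<exists>x \<theta>h \<tau>.
        hybrid_solution \<Theta> f g k V a T \<theta> x \<theta>h \<tau> \<and> x 0 = x0 \<and> \<theta>h 0 = \<theta>0 \<and>
        (\<forall>x' \<theta>h' \<tau>'.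
          hybrid_solution \<Theta> f g k V a T \<theta> x' \<theta>h' \<tau>' \<and> x' 0 = x0 \<and> \<theta>h' 0 = \<theta>0 \<longrightarrow>
            \<tau>' = \<tau> \<and> (\<forall>t\<ge>0. x' t = x t \<and> \<theta>h' t = \<theta>h t)) \<and>
        filterlim \<tau> at_top sequentially \<and>
        (\<forall>t\<ge>0. norm (x t) \<le> M * exp (- \<sigma> * t) * norm x0))"
    for \<theta> \<theta>0 :: "real^'l" and M :: real and x0 :: "real^'n"
  have "\<exists>M R. M > 0 \<and> R > 0 \<and> (\<forall>x0. norm x0 \<le> R \<longrightarrow> decays \<theta> \<theta>0 M x0)"
    if \<theta>: "\<theta> \<in> \<Theta>" and \<theta>0: "\<theta>0 \<in> \<Theta>" for \<theta> \<theta>0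
  proof -
    \<comment> \<open>Since updates never increase the error, all estimates lie in the compact set
      \<open>?K\<close>, which is determined by \<open>\<theta>\<close> and
      \<open>\<theta>0\<close>.\<close>
    define r0 where "r0 = norm (\<theta>0 - \<theta>)"
    let ?K = "\<Theta> \<inter> cball \<theta> r0"
    have "?K \<noteq> {}" using \<theta> by (auto simp: r0_def)
    moreover have "compact ?K" by (rule closed_Int_compact[OF \<open>closed \<Theta>\<close> compact_cball])
    ultimately obtain R K1 K2 where R: "R > 0" and K: "K2 > K1" "K1 > 0"
      and quadratic: "\<forall>x. \<forall>\<theta>\<in>?K. norm x \<le> R \<longrightarrow>
          K1 * (norm x)\<^sup>2 \<le> V (\<theta>, x) \<and> V (\<theta>, x) \<le> K2 * (norm x)\<^sup>2"
      using assms(19)[of ?K] by auto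
    have inK: "\<eta> \<in> ?K" if "\<eta> \<in> \<Theta>" "norm (\<eta> - \<theta>) \<le> r0" for \<eta>
      using that by (simp add: dist_norm norm_minus_commute)
    obtain A0 where A0: "\<forall>q\<in>{a x / (norm x)\<^sup>2 | x. x \<noteq> 0 \<and> norm x \<le> \<delta>}. q \<le> A0"
      using assms(25) unfolding bdd_above_def by blast
    \<comment> \<open>The maximum secures \<open>A \<ge> 0\<close>, hence
      \<open>1 + A / K1 \<ge> 1\<close>. Within \<open>\<rho>\<close> both the bounds on
      \<open>V\<close> and the bound on \<open>a\<close> hold.\<close>
    define A where "A = max A0 0"
    define \<rho> where "\<rho> = min R \<delta>"
    have threshold: "a y \<le> A * (norm y)\<^sup>2" if "norm y \<le> \<rho>" for y
    proof (cases "y = 0")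
      case True
      then show ?thesis using \<open>pos_def_fun a\<close> by (simp add: pos_def_fun_def)
    next
      case False
      have "norm y \<le> \<delta>" using that by (simp add: \<rho>_def)
      then have "a y / (norm y)\<^sup>2 \<le> A0" using A0 False by blast
      then have "a y / (norm y)\<^sup>2 \<le> A" by (simp add: A_def)
      then show ?thesis using False by (simp add: pos_divide_le_eq)
    qed
    have contV: "continuous_on UNIV (\<lambda>y. V (\<eta>, y))" if "\<eta> \<in> \<Theta>" for \<eta>
      by (rule continuous_on_compose2[OF assms(10)]) (use that in \<open>auto intro!: continuous_intros\<close>)
    have diffV: "(\<lambda>y. V (\<eta>, y)) differentiable (at y)" if "\<eta> \<in> \<Theta>" for \<eta> y
      using assms(12)[OF that] by simp
    have "local_bounds \<Theta> f g k V a T \<theta> \<sigma> K1 K2 A \<rho> r0"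
    proof (intro_locales, unfold adaptive_loop_def local_bounds_axioms_def, safe)
      show "closed \<Theta>" "convex \<Theta>" "pos_def_fun a" "T > 0" "\<sigma> > 0" by fact+
      show "continuous_on UNIV f" "continuous_on UNIV g" "continuous_on (\<Theta> \<times> UNIV) k"
        by (intro local_lip_on_continuous smooth_map_on_local_lip assms)+
      show "0 < \<rho>" using R \<open>\<delta> > 0\<close> by (simp add: \<rho>_def)
      show "0 \<le> A" by (simp add: A_def)
      fix \<eta> assume \<eta>: "\<eta> \<in> \<Theta>"
      show "locally_lip (loop_field f g k \<theta> \<eta>)"
        by (rule locally_lip_loop_field[OF assms(3,4,7) \<eta>])
      show "loop_field f g k \<theta> \<eta> 0 = 0"
        using assms(5,6) assms(8)[OF \<eta>] by (simp add: loop_field_def)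
      fix y
      show "frechet_derivative (\<lambda>y. V (\<eta>, y)) (at y) (f (y, k (\<eta>, y)) + g (y, k (\<eta>, y)) *v \<eta>)
          \<le> - 2 * \<sigma> * V (\<eta>, y)"
        by (rule H1[OF \<eta>])
      assume "norm (\<eta> - \<theta>) \<le> r0" "norm y \<le> \<rho>"
      then show "K1 * (norm y)\<^sup>2 \<le> V (\<eta>, y)" "V (\<eta>, y) \<le> K2 * (norm y)\<^sup>2"
        using quadratic inK[OF \<eta>] by (simp_all add: \<rho>_def)
    qed (fact \<theta> K threshold contV diffV)+
    then interpret local_bounds \<Theta> f g k V a T \<theta> \<sigma> K1 K2 A \<rho> r0 .
    define q where "q = B ^ Suc CARD('l) * K2"
    have "1 * K1 \<le> q" unfolding q_def
      by (intro mult_mono one_le_power B_ge_1) (use K B_ge_1 in simp_all)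
    then have q: "K1 \<le> q" "q > 0" using K by simp_all
    \<comment> \<open>Since \<open>K1 \<le> q\<close>, this gives
      \<open>R0 \<le> \<rho> / 2\<close>, and \<open>q * R0\<^sup>2 = (\<rho> * K1 / 2) * R0\<close>
      is at most a quarter of \<open>K1 * \<rho>\<^sup>2\<close>. So both smallness conditions hold
      strictly.\<close>
    define R0 where "R0 = \<rho> * K1 / (2 * q)"
    have R0: "R0 > 0" using \<rho> K q by (simp add: R0_def)
    have "decays \<theta> \<theta>0 (sqrt (q / K1)) x0" if x0: "norm x0 \<le> R0" for x0
    proof -
      have R0_le: "R0 \<le> \<rho> / 2"
        using \<rho> K q by (simp add: R0_def pos_divide_le_eq)
      have "q * (norm x0)\<^sup>2 \<le> q * R0\<^sup>2"
        using x0 q by (intro mult_left_mono power_mono) simp_all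
      also have "\<dots> = (q * R0) * R0" by (simp add: power2_eq_square)
      also have "\<dots> = (\<rho> * K1 / 2) * R0" using q by (simp add: R0_def)
      also have "\<dots> \<le> (\<rho> * K1 / 2) * (\<rho> / 2)"
        by (rule mult_left_mono[OF R0_le]) (use \<rho> K in simp)
      also have "\<dots> < K1 * \<rho>\<^sup>2" using \<rho> K by (simp add: power2_eq_square)
      finally have small: "B ^ Suc CARD('l) * (K2 * (norm x0)\<^sup>2) < K1 * \<rho>\<^sup>2"
        by (simp add: q_def mult.assoc)
      have near: "norm (\<theta>0 - \<theta>) \<le> r0" by (simp add: r0_def)
      have "norm x0 < \<rho>" using x0 R0_le \<rho> by linarith
      from hybrid_solution_exponential[OF \<theta>0 near this small] show ?thesis
        unfolding q_def decays_def .
    qed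
    moreover have "sqrt (q / K1) > 0" using q K by simp
    ultimately show ?thesis using R0 by blast
  qed
  then obtain M R where MR: "\<And>\<theta> \<theta>0. \<theta> \<in> \<Theta> \<Longrightarrow> \<theta>0 \<in> \<Theta> \<Longrightarrow>
      M \<theta> \<theta>0 > 0 \<and> R \<theta> \<theta>0 > 0 \<and> (\<forall>x0. norm x0 \<le> R \<theta> \<theta>0 \<longrightarrow> decays \<theta> \<theta>0 (M \<theta> \<theta>0) x0)"
    by metis
  then have "(\<forall>\<theta>\<in>\<Theta>. \<forall>\<eta>\<in>\<Theta>. M \<theta> \<eta> > 0 \<and> R \<theta> \<eta> > 0) \<and>
      (\<forall>\<theta>\<in>\<Theta>. \<forall>x0. \<forall>\<theta>0\<in>\<Theta>. norm x0 \<le> R \<theta> \<theta>0 \<longrightarrow> decays \<theta> \<theta>0 (M \<theta> \<theta>0) x0)"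
    by blast
  then show ?thesis
    unfolding decays_def by (intro exI[of _ M] exI[of _ R])
qed

end
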